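(* Let $G$ be a finite group having a cyclic subgroup of index $2$. Then $$\mathsf D(G)=\mathsf d(G)+|G'| \quad\text{and}\quad \mathsf d(G)=\begin{cases}|G|-1 & \text{if } G \text{ is cyclic},\\ \tfrac12|G| & \text{if } G\text{ is non-cyclic},\end{cases}$$ where $G'=[G,G]\leq G$ is the commutator subgroup of $G$.
   Context: Let $G$ be a multiplicatively written finite group. A sequence over $G$ is a finite unordered sequence of terms from $G$ with repetition allowed (a finite multiset), i.e. an element of the free abelian monoid with basis $G$; its length is its number of terms counted with multiplicity; the trivial sequence is the empty one, and subsequence means sub-multiset. A sequence is a product-one sequence if its terms can be ordered so that their product (in that order) is $1$. The small Davenport constant $\mathsf d(G)$ is the maximal length of a sequence over $G$ having no nontrivial product-one subsequence. A minimal product-one sequence (atom) is a nontrivial product-one sequence which cannot be factored (partitioned as a multiset) into two nontrivial product-one subsequences. The large Davenport constant $\mathsf D(G)$ is the maximal length of a minimal product-one sequence over $G$. *)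

theory Defs
  imports "HOL-Algebra.Algebra" "HOL-Library.Multiset"
begin

text \<open>A sequence over a group is a finite multiset of elements of its carrier.\<close>

definition product_one :: "('a, 'b) monoid_scheme \<Rightarrow> 'a multiset \<Rightarrow> bool" where
  "product_one G S \<longleftrightarrow> set_mset S \<subseteq> carrier G \<and>
     (\<exists>xs. mset xs = S \<and> foldr (\<otimes>\<^bsub>G\<^esub>) xs \<one>\<^bsub>G\<^esub> = \<one>\<^bsub>G\<^esub>)"

definition product_one_free :: "('a, 'b) monoid_scheme \<Rightarrow> 'a multiset \<Rightarrow> bool" where
  "product_one_free G S \<longleftrightarrow> set_mset S \<subseteq> carrier G \<and>
     \<not> (\<exists>T. T \<subseteq># S \<and> T \<noteq> {#} \<and> product_one G T)"

definition minimal_product_one :: "('a, 'b) monoid_scheme \<Rightarrow> 'a multiset \<Rightarrow> bool" where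
  "minimal_product_one G S \<longleftrightarrow> S \<noteq> {#} \<and> product_one G S \<and>
     \<not> (\<exists>T U. S = T + U \<and> T \<noteq> {#} \<and> U \<noteq> {#} \<and> product_one G T \<and> product_one G U)"

definition small_davenport :: "('a, 'b) monoid_scheme \<Rightarrow> nat" where
  "small_davenport G = Max {size S | S. product_one_free G S}"

definition large_davenport :: "('a, 'b) monoid_scheme \<Rightarrow> nat" where
  "large_davenport G = Max {size S | S. minimal_product_one G S}"

text \<open>For a finite group both maxima range over finite nonempty sets of lengths, by the
  pigeonhole principle applied to partial products, so they are attained.\<close>

context group
begin

lemma foldr_mult_closed:
  "set xs \<subseteq> carrier G \<Longrightarrow> foldr (\<otimes>) xs \<one> \<in> carrier G"
  by (induction xs) auto

lemma foldr_mult_append: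
  "set xs \<subseteq> carrier G \<Longrightarrow> set ys \<subseteq> carrier G \<Longrightarrow>
    foldr (\<otimes>) (xs @ ys) \<one> = foldr (\<otimes>) xs \<one> \<otimes> foldr (\<otimes>) ys \<one>"
  by (induction xs) (auto simp: m_assoc foldr_mult_closed simp del: foldr_append)

lemma product_one_segment:
  assumes fin: "finite (carrier G)" and xs: "set xs \<subseteq> carrier G"
    and len: "length xs \<ge> order G"
  obtains us vs ws where "xs = us @ vs @ ws" "vs \<noteq> []" "foldr (\<otimes>) vs \<one> = \<one>"
proof -
  let ?p = "\<lambda>i. foldr (\<otimes>) (take i xs) \<one>"
  have sub: "?p ` {..length xs} \<subseteq> carrier G"
    using xs by (auto intro!: foldr_mult_closed dest: in_set_takeD)
  have "card (?p ` {..length xs}) \<le> order G"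
    unfolding order_def by (rule card_mono[OF fin sub])
  then have "\<not> inj_on ?p {..length xs}"
    using len card_image[of ?p "{..length xs}"] by auto
  then obtain i j where ij: "i < j" "j \<le> length xs" "?p i = ?p j"
    unfolding inj_on_def by (metis atMost_iff nat_neq_iff)
  define vs where "vs = take (j - i) (drop i xs)"
  have tj: "take j xs = take i xs @ vs"
    unfolding vs_def using ij by (metis le_add_diff_inverse less_imp_le take_add)
  have us_in: "set (take i xs) \<subseteq> carrier G" and vs_in: "set vs \<subseteq> carrier G"
    using xs unfolding vs_def by (auto dest: in_set_takeD in_set_dropD)
  have "?p j = ?p i \<otimes> foldr (\<otimes>) vs \<one>"
    unfolding tj by (rule foldr_mult_append[OF us_in vs_in])
  then have "?p i \<otimes> foldr (\<otimes>) vs \<one> = ?p i"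
    using ij(3) by simp
  then have "foldr (\<otimes>) vs \<one> = \<one>"
    using l_cancel_one[OF foldr_mult_closed[OF us_in] foldr_mult_closed[OF vs_in]] by simp
  moreover have "vs \<noteq> []"
    unfolding vs_def using ij by simp
  moreover have "xs = take i xs @ vs @ drop j xs"
    using tj by (metis append.assoc append_take_drop_id)
  ultimately show thesis
    using that by blast
qed

lemma product_one_free_size_less:
  assumes fin: "finite (carrier G)" and S: "product_one_free G S"
  shows "size S < order G"
proof (rule ccontr)
  assume ge: "\<not> size S < order G"
  obtain xs where xs: "mset xs = S"
    using ex_mset by blast
  have sub: "set xs \<subseteq> carrier G"
    using S xs unfolding product_one_free_def by auto
  have "length xs \<ge> order G"
    using ge xs by auto
  then obtain us vs ws where seg: "xs = us @ vs @ ws" "vs \<noteq> []" "foldr (\<otimes>) vs \<one> = \<one>"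
    by (rule product_one_segment[OF fin sub])
  have "product_one G (mset vs)"
    unfolding product_one_def using seg sub by auto
  moreover have "mset vs \<subseteq># S" "mset vs \<noteq> {#}"
    using xs seg by auto
  ultimately show False
    using S unfolding product_one_free_def by blast
qed

lemma minimal_product_one_size_le:
  assumes fin: "finite (carrier G)" and S: "minimal_product_one G S"
  shows "size S \<le> order G"
proof (rule ccontr)
  assume gr: "\<not> size S \<le> order G"
  obtain xs where xs: "mset xs = S" "foldr (\<otimes>) xs \<one> = \<one>" "set xs \<subseteq> carrier G"
    using S unfolding minimal_product_one_def product_one_def by auto
  have "xs \<noteq> []"
    using gr xs(1) by auto
  then obtain a ys where ys: "xs = a # ys"
    by (cases xs) simp_all
  have ys_in: "set ys \<subseteq> carrier G" and a: "a \<in> carrier G"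
    using xs ys by auto
  have "length ys \<ge> order G"
    using gr xs(1) ys by auto
  then obtain us vs ws where seg: "ys = us @ vs @ ws" "vs \<noteq> []" "foldr (\<otimes>) vs \<one> = \<one>"
    by (rule product_one_segment[OF fin ys_in])
  have in_carr: "set us \<subseteq> carrier G" "set vs \<subseteq> carrier G" "set ws \<subseteq> carrier G"
    using ys_in seg by auto
  have "foldr (\<otimes>) (us @ vs @ ws) \<one> = foldr (\<otimes>) (us @ ws) \<one>"
    using in_carr seg(3) by (simp add: foldr_mult_append foldr_mult_closed del: foldr_append)
  then have rest: "foldr (\<otimes>) (a # us @ ws) \<one> = \<one>"
    using xs(2) ys seg(1) by (simp del: foldr_append)
  have "product_one G (mset vs)"
    unfolding product_one_def using seg(3) in_carr by auto
  moreover have "product_one G (mset (a # us @ ws))"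
    unfolding product_one_def
  proof
    show "set_mset (mset (a # us @ ws)) \<subseteq> carrier G"
      using in_carr a by auto
    show "\<exists>xs. mset xs = mset (a # us @ ws) \<and> foldr (\<otimes>) xs \<one> = \<one>"
      using rest by blast
  qed
  moreover have "S = mset vs + mset (a # us @ ws)"
    using xs(1) ys seg(1) by auto
  moreover have "mset vs \<noteq> {#}" "mset (a # us @ ws) \<noteq> {#}"
    using seg(2) by auto
  ultimately show False
    using S unfolding minimal_product_one_def by blast
qed

lemma finite_product_one_free_sizes:
  assumes "finite (carrier G)"
  shows "finite {size S | S. product_one_free G S}" "{size S | S. product_one_free G S} \<noteq> {}"
proof -
  show "finite {size S | S. product_one_free G S}"
    by (rule finite_subset[OF _ finite_lessThan[of "order G"]]) (auto dest: product_one_free_size_less[OF assms])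
  have "product_one_free G {#}"
    by (auto simp: product_one_free_def)
  then show "{size S | S. product_one_free G S} \<noteq> {}"
    by blast
qed

lemma finite_minimal_product_one_sizes:
  assumes "finite (carrier G)"
  shows "finite {size S | S. minimal_product_one G S}"
    "{size S | S. minimal_product_one G S} \<noteq> {}"
proof -
  show "finite {size S | S. minimal_product_one G S}"
    by (rule finite_subset[OF _ finite_atMost[of "order G"]]) (auto dest: minimal_product_one_size_le[OF assms])
  have "product_one G {#\<one>#}"
    unfolding product_one_def by (auto intro!: exI[of _ "[\<one>]"])
  then have "minimal_product_one G {#\<one>#}"
    unfolding minimal_product_one_def by (auto simp: single_is_union)
  then show "{size S | S. minimal_product_one G S} \<noteq> {}"
    by blast
qed

end

end

theory Submission
  imports Defs
begin

text \<open>Let \<open>a\<close> generate the cyclic subgroup, let \<open>n\<close> be its order, and let \<open>x\<close> be an element outside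
  it, so that \<open>x a = a\<^sup>r x\<close> and \<open>x\<^sup>2 = a\<^sup>s\<close>. The commutator subgroup has order
  \<open>N = n / gcd n (r - 1)\<close>, and modulo \<open>N\<close> the group looks dihedral: \<open>r = -1\<close> and \<open>s = 0\<close>. The powers
  of \<open>a\<^sup>N\<close> form a central cyclic group of order \<open>n / N\<close>, so among \<open>n / N\<close> disjoint blocks with
  products in it some nonempty selection has product one.

  A product-one sequence with more than \<open>n + N\<close> terms splits off \<open>n / N\<close> such blocks, of length at
  most \<open>N\<close> except for the last, the rest being nonempty, hence it is not minimal. For the splitting,
  the reflections (the elements outside \<open>\<langle>a\<rangle>\<close>) alternately occupy positions where they count with
  signs \<open>+\<close> and \<open>-\<close>. Two congruent reflections of opposite signs form a block. If there are none,
  then the residues of one side fill at most half of the classes. Holding back one representative of each of them, \<open>N\<close> pairs of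
  opposite reflections and rotations remain; a zero-sum subset of these can be moved to the opposite
  sign without changing the product, and this creates a congruent pair of opposite signs.

  The bound \<open>n\<close> for product-one free sequences comes from blocks in the same way, modulo \<open>2\<close> if \<open>n\<close>
  and \<open>s\<close> are even, and otherwise modulo \<open>N\<close>, which is then odd.\<close>

section \<open>Zero-sum submultisets and shifts modulo N\<close>

text \<open>Pigeonhole on the \<open>N + 1\<close> partial sums along the first \<open>N\<close>
  entries of an enumeration: two of them agree modulo \<open>N\<close>, and the segment between them
  is the required part.\<close>

lemma zero_sum_submultiset:
  fixes f :: "'c \<Rightarrow> int" and N :: int
  assumes N: "0 < N" and size: "N \<le> int (size F)"
  obtains I where "I \<subseteq># F" "I \<noteq> {#}" "int (size I) \<le> N" "N dvd (\<Sum>i\<in>#I. f i)"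
proof -
  obtain xs where xs: "mset xs = F"
    using ex_mset by blast
  define p where "p i = sum_list (map f (take i xs)) mod N" for i
  have "card (p ` {..nat N}) \<le> card {0..<N}"
    by (rule card_mono) (use N in \<open>auto simp: p_def\<close>)
  then have "\<not> inj_on p {..nat N}"
    using N card_image[of p "{..nat N}"] by auto
  then obtain i j where ij: "i < j" "j \<le> nat N" "p i = p j"
    unfolding inj_on_def by (metis atMost_iff nat_neq_iff)
  have j: "j \<le> length xs"
    using ij size xs by auto
  define ys where "ys = take (j - i) (drop i xs)"
  have tj: "take j xs = take i xs @ ys"
    unfolding ys_def using ij by (metis le_add_diff_inverse less_imp_le take_add)
  have "N dvd sum_list (map f (take j xs)) - sum_list (map f (take i xs))"
    using ij(3) unfolding p_def by (metis mod_eq_dvd_iff)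
  then have dvd: "N dvd (\<Sum>i\<in>#mset ys. f i)"
    by (simp add: tj flip: sum_mset_sum_list)
  have len: "length ys = j - i"
    unfolding ys_def using j by simp
  have "xs = take i xs @ ys @ drop j xs"
    by (metis append.assoc append_take_drop_id tj)
  then have "mset xs = mset (take i xs) + mset ys + mset (drop j xs)"
    by (metis mset_append add.assoc)
  then have "mset ys \<subseteq># F"
    using xs by simp
  moreover have "mset ys \<noteq> {#}"
    using len ij by auto
  moreover have "int (size (mset ys)) \<le> N"
    using len ij by auto
  ultimately show thesis
    using that dvd by blast
qed

lemma obtain_submultiset_of_size:
  assumes "k \<le> size M"
  obtains M' where "M' \<subseteq># M" "size M' = k"
proof -
  obtain xs where xs: "mset xs = M"
    using ex_mset by blast
  have "mset (take k xs) \<subseteq># M"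
    by (metis xs append_take_drop_id mset_append mset_subset_eq_add_left)
  moreover have "size (mset (take k xs)) = k"
    using assms xs by auto
  ultimately show thesis
    using that by blast
qed

text \<open>This is \<open>zero_sum_submultiset\<close> for pairs \<open>(b, b')\<close> with value
  \<open>b - b'\<close> and for singles with their own value. The pairs will be reflections of
  opposite signs, the singles rotations of sign \<open>+\<close>.\<close>

lemma zero_sum_pairs_singles:
  fixes N :: int
  assumes N: "0 < N" and eq: "size F = size F'" and size: "N \<le> int (size F + size P)"
  obtains U U' J where "U \<subseteq># F" "U' \<subseteq># F'" "J \<subseteq># P" "size U = size U'"
    "U \<noteq> {#} \<or> J \<noteq> {#}" "N dvd (\<Sum>\<^sub># U - \<Sum>\<^sub># U' + \<Sum>\<^sub># J)"
proof -
  obtain fs fs' where fs: "mset fs = F" "mset fs' = F'"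
    using ex_mset by metis
  have len: "length fs = length fs'"
    using eq fs by auto
  \<comment> \<open>Pairs and singles share a sum type. The maps \<open>u\<close>,
    \<open>u'\<close>, \<open>j\<close> send an item to its contribution to \<open>U\<close>,
    \<open>U'\<close>, \<open>J\<close>, so summing them over a submultiset of \<open>E\<close>
    recovers all three.\<close>
  define E :: "(int \<times> int + int) multiset"
    where "E = image_mset Inl (mset (zip fs fs')) + image_mset Inr P"
  define u u' j :: "int \<times> int + int \<Rightarrow> int multiset"
    where "u = case_sum (\<lambda>(b, b'). {#b#}) (\<lambda>_. {#})"
      and "u' = case_sum (\<lambda>(b, b'). {#b'#}) (\<lambda>_. {#})"
      and "j = case_sum (\<lambda>_. {#}) (\<lambda>h. {#h#})"
  define f where "f e = \<Sum>\<^sub># (u e) - \<Sum>\<^sub># (u' e) + \<Sum>\<^sub># (j e)" for e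
  have "size E = size F + size P"
    using fs len unfolding E_def by auto
  then obtain I where I: "I \<subseteq># E" "I \<noteq> {#}" "N dvd (\<Sum>i\<in>#I. f i)"
    using zero_sum_submultiset[OF N, of E f] size by metis
  have zipE: "\<Sum>\<^sub># (image_mset u E) = F" "\<Sum>\<^sub># (image_mset u' E) = F'"
    "\<Sum>\<^sub># (image_mset j E) = P"
  proof -
    have 1: "\<Sum>\<^sub># (image_mset (\<lambda>x. {#g x#}) M) = image_mset g M" for g :: "'c \<Rightarrow> 'd" and M
      by (induction M) auto
    have "\<Sum>\<^sub># (image_mset u E) = image_mset fst (mset (zip fs fs'))"
      unfolding E_def u_def by (simp add: multiset.map_comp comp_def case_prod_unfold 1)
    also have "\<dots> = F"
      using len fs by (metis map_fst_zip mset_map)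
    finally show "\<Sum>\<^sub># (image_mset u E) = F" .
    have "\<Sum>\<^sub># (image_mset u' E) = image_mset snd (mset (zip fs fs'))"
      unfolding E_def u'_def by (simp add: multiset.map_comp comp_def case_prod_unfold 1)
    also have "\<dots> = F'"
      using len fs by (metis map_snd_zip mset_map)
    finally show "\<Sum>\<^sub># (image_mset u' E) = F'" .
    show "\<Sum>\<^sub># (image_mset j E) = P"
      unfolding E_def j_def by (simp add: multiset.map_comp comp_def case_prod_unfold 1)
  qed
  have mono: "\<Sum>\<^sub># (image_mset g I) \<subseteq># \<Sum>\<^sub># (image_mset g E)" for g :: "_ \<Rightarrow> int multiset"
    using I(1) by (metis image_mset_union mset_subset_eq_add_left subset_mset.add_diff_inverse sum_mset.union)
  have sumf: "(\<Sum>i\<in>#M. f i) = \<Sum>\<^sub># (\<Sum>\<^sub># (image_mset u M)) - \<Sum>\<^sub># (\<Sum>\<^sub># (image_mset u' M)) +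
      \<Sum>\<^sub># (\<Sum>\<^sub># (image_mset j M))" for M
    by (induction M) (auto simp: f_def)
  have sz: "size (\<Sum>\<^sub># (image_mset u M)) = size (\<Sum>\<^sub># (image_mset u' M))" for M
    by (induction M) (auto simp: u_def u'_def split: sum.splits)
  have ne: "\<Sum>\<^sub># (image_mset u I) \<noteq> {#} \<or> \<Sum>\<^sub># (image_mset j I) \<noteq> {#}"
  proof -
    obtain e I' where "I = add_mset e I'"
      using I(2) by (meson multiset_cases)
    then show ?thesis
      by (cases e) (auto simp: u_def j_def)
  qed
  show thesis
  proof (rule that)
    show "\<Sum>\<^sub># (image_mset u I) \<subseteq># F" "\<Sum>\<^sub># (image_mset u' I) \<subseteq># F'"
      "\<Sum>\<^sub># (image_mset j I) \<subseteq># P"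
      using mono[of u] mono[of u'] mono[of j] unfolding zipE .
    show "size (\<Sum>\<^sub># (image_mset u I)) = size (\<Sum>\<^sub># (image_mset u' I))"
      by (rule sz)
    show "\<Sum>\<^sub># (image_mset u I) \<noteq> {#} \<or> \<Sum>\<^sub># (image_mset j I) \<noteq> {#}"
      by (rule ne)
    show "N dvd (\<Sum>\<^sub># (\<Sum>\<^sub># (image_mset u I)) - \<Sum>\<^sub># (\<Sum>\<^sub># (image_mset u' I)) +
        \<Sum>\<^sub># (\<Sum>\<^sub># (image_mset j I)))"
      using I(3) unfolding sumf .
  qed
qed

text \<open>Choosing one element of \<open>B\<close> for each residue that occurs keeps a congruent
  partner available for every element of \<open>B - R\<close>.\<close>

lemma residue_representatives:
  fixes N :: int
  assumes "0 < N"
  obtains R where "R \<subseteq># B" "size R = card ((\<lambda>b. b mod N) ` set_mset B)"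
    "\<And>b. b \<in># B \<Longrightarrow> \<exists>r\<in>#R. r mod N = b mod N"
proof -
  have "\<forall>c\<in>(\<lambda>b. b mod N) ` set_mset B. \<exists>b. b \<in># B \<and> b mod N = c"
    by auto
  then obtain r where r: "\<And>c. c \<in> (\<lambda>b. b mod N) ` set_mset B \<Longrightarrow> r c \<in># B \<and> r c mod N = c"
    by (metis (no_types) bchoice)
  let ?C = "(\<lambda>b. b mod N) ` set_mset B"
  have inj: "inj_on r ?C"
    by (rule inj_on_inverseI[where g = "\<lambda>b. b mod N"]) (use r in blast)
  have "mset_set (r ` ?C) \<subseteq># mset_set (set_mset B)"
    by (rule subset_imp_msubset_mset_set) (use r in auto)
  also have "\<dots> \<subseteq># B"
    by (rule mset_set_set_mset_msubset)
  finally have "mset_set (r ` ?C) \<subseteq># B" .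
  moreover have "size (mset_set (r ` ?C)) = card ?C"
    using card_image[OF inj] by simp
  moreover have "\<exists>q\<in>#mset_set (r ` ?C). q mod N = b mod N" if "b \<in># B" for b
    using r that by auto
  ultimately show thesis
    using that by blast
qed

section \<open>Translates of sets of residues\<close>

definition shift_mod :: "int \<Rightarrow> int \<Rightarrow> int set \<Rightarrow> int set" where
  "shift_mod N d A = (\<lambda>z. (z + d) mod N) ` A"

lemma shift_mod_shift_mod: "shift_mod N d (shift_mod N e A) = shift_mod N (d + e) A"
  unfolding shift_mod_def image_image by (simp add: mod_simps algebra_simps)

lemma card_shift_mod:
  assumes "A \<subseteq> {0..<N}"
  shows "card (shift_mod N d A) = card A"
proof -
  have "inj_on (\<lambda>z. (z + d) mod N) A"
  proof (rule inj_onI)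
    fix x y assume "x \<in> A" "y \<in> A" "(x + d) mod N = (y + d) mod N"
    then have "N dvd x - y" "x \<in> {0..<N}" "y \<in> {0..<N}"
      using assms by (auto simp: mod_eq_dvd_iff)
    then show "x = y"
      by (metis atLeastLessThan_iff mod_eq_dvd_iff mod_pos_pos_trivial)
  qed
  then show ?thesis
    unfolding shift_mod_def by (rule card_image)
qed

lemma zero_in_shift_mod:
  assumes "A \<subseteq> {0..<N}"
  shows "0 \<in> shift_mod N d A \<longleftrightarrow> (\<exists>z\<in>A. N dvd z + d)"
  unfolding shift_mod_def by (auto simp: dvd_eq_mod_eq_0 intro: rev_image_eqI)

text \<open>The translate has as many elements as \<open>A\<close> but misses \<open>0\<close>, so
  it is not contained in \<open>A\<close>.\<close>

lemma card_Un_shift_mod: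
  assumes N: "0 < N" and A: "A \<subseteq> {0..<N}" "0 \<in> A" and d: "0 \<notin> shift_mod N d A"
  shows "card A + 1 \<le> card (A \<union> shift_mod N d A)"
proof -
  have fin: "finite A" "finite (shift_mod N d A)"
    using A finite_subset unfolding shift_mod_def by auto
  have "shift_mod N d A \<noteq> A"
    using A(2) d by auto
  then have "\<not> shift_mod N d A \<subseteq> A"
    using card_subset_eq[OF fin(1)] card_shift_mod[OF A(1)] by auto
  then have "A \<subset> A \<union> shift_mod N d A"
    by auto
  then show ?thesis
    using psubset_card_mono[of "A \<union> shift_mod N d A" A] fin by auto
qed

text \<open>If the union had at most one element outside \<open>A\<close>, both translates would
  equal the union without \<open>0\<close>. Then \<open>A\<close> has period \<open>2 * d\<close>,
  hence period \<open>d\<close> as \<open>N\<close> is odd, although \<open>0\<close> lies in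
  \<open>A\<close> and not in its translate by \<open>d\<close>.\<close>

lemma card_Un_shift_mod_both:
  assumes N: "0 < N" "odd N" and A: "A \<subseteq> {0..<N}" "0 \<in> A"
    and d: "0 \<notin> shift_mod N d A" "0 \<notin> shift_mod N (- d) A"
  shows "card A + 2 \<le> card (A \<union> shift_mod N d A \<union> shift_mod N (- d) A)"
proof (rule ccontr)
  let ?Y = "A \<union> shift_mod N d A \<union> shift_mod N (- d) A"
  assume "\<not> card A + 2 \<le> card ?Y"
  then have le: "card ?Y \<le> card A + 1"
    by simp
  have finA: "finite A"
    using A finite_subset by auto
  then have fin: "finite ?Y"
    unfolding shift_mod_def by auto
  have eq: "shift_mod N e A = ?Y - {0}"
    if "0 \<notin> shift_mod N e A" "shift_mod N e A \<subseteq> ?Y" for e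
  proof (rule card_subset_eq)
    show "finite (?Y - {0})"
      using fin by simp
    show sub: "shift_mod N e A \<subseteq> ?Y - {0}"
      using that by auto
    have "card (?Y - {0}) = card ?Y - 1"
      using A(2) by (subst card_Diff_singleton) auto
    then show "card (shift_mod N e A) = card (?Y - {0})"
      using le card_mono[OF _ sub] fin card_shift_mod[OF A(1)] by auto
  qed
  have "shift_mod N d A = shift_mod N (- d) A"
    using eq[of d] eq[of "- d"] d by auto
  then have "shift_mod N d (shift_mod N d A) = shift_mod N 0 A"
    by (metis shift_mod_shift_mod add.right_inverse)
  moreover have s0: "shift_mod N 0 A = A"
  proof -
    have "(\<lambda>z. (z + 0) mod N) ` A = (\<lambda>z. z) ` A"
      by (rule image_cong) (use A(1) in auto)
    then show ?thesis
      unfolding shift_mod_def by simp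
  qed
  ultimately have per: "shift_mod N (2 * d) A = A"
    by (metis shift_mod_shift_mod mult_2)
  have pers: "shift_mod N (int k * (2 * d)) A = A" for k
  proof (induction k)
    case (Suc k)
    have "shift_mod N (int (Suc k) * (2 * d)) A = shift_mod N (2 * d) (shift_mod N (int k * (2 * d)) A)"
      unfolding shift_mod_shift_mod by (simp add: algebra_simps)
    then show ?case
      unfolding Suc per .
  qed (simp add: s0)
  obtain k where k: "N = 2 * k + 1"
    using N(2) oddE by blast
  \<comment> \<open>Since \<open>2 * (k + 1) = N + 1\<close>, a multiple of the period
    \<open>2 * d\<close> is congruent to \<open>d\<close>.\<close>
  then have "int (nat (k + 1)) * (2 * d) = d + N * d"
    using N(1) by (simp add: algebra_simps)
  then have "shift_mod N (d + N * d) A = A"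
    using pers by metis
  moreover have "shift_mod N (d + N * d) A = shift_mod N d A"
    unfolding shift_mod_def by (metis add.assoc mod_mult_self2)
  ultimately show False
    using A(2) d(1) by simp
qed

lemma pos_int_SucE:
  assumes "0 < (e :: int)"
  obtains g where "e = int (Suc g)"
  using assms that[of "nat e - 1"] by simp

lemma size_2_multisetE:
  assumes "size M = 2"
  obtains b b' where "M = {#b, b'#}"
proof -
  obtain b M' where M': "M = add_mset b M'"
    using assms by (cases M) auto
  then have "size M' = 1"
    using assms by simp
  then show thesis
    using that M' size_1_singleton_mset by metis
qed

text \<open>With more elements than residues, some element lies outside a system of representatives.
  The pair is a submultiset, so two equal values must come from two occurrences.\<close>

lemma congruent_pair:
  fixes k :: int
  assumes k: "0 < k" and size: "k < int (size M)"
  obtains b b' where "{#b, b'#} \<subseteq># M" "k dvd b - b'"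
proof -
  obtain R where R: "R \<subseteq># M" "size R = card ((\<lambda>b. b mod k) ` set_mset M)"
    "\<And>b. b \<in># M \<Longrightarrow> \<exists>c\<in>#R. c mod k = b mod k"
    using residue_representatives[OF k, of M] by blast
  have "card ((\<lambda>b. b mod k) ` set_mset M) \<le> card {0..<k}"
    by (rule card_mono) (use k in auto)
  then have "size R < size M"
    using R(2) size k by auto
  then have "M - R \<noteq> {#}"
    using R(1) by (metis nonempty_has_size size_Diff_submset zero_less_diff)
  then obtain b where b: "b \<in># M - R"
    by (meson multiset_nonemptyE)
  then obtain c where c: "c \<in># R" "c mod k = b mod k"
    using R(3) by (meson in_diffD)
  have "{#c#} + {#b#} \<subseteq># R + (M - R)"
    using b c by (intro subset_mset.add_mono) auto
  then have "{#c, b#} \<subseteq># M"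
    using R(1) by (simp add: add_mset_commute)
  moreover have "k dvd c - b"
    using c by (simp add: mod_eq_dvd_iff)
  ultimately show thesis
    using that by blast
qed

text \<open>Group elements determine exponents only modulo \<open>n\<close>; with
  \<open>c = 1\<close> this evaluates the exponent sum of copies of \<open>rot 1\<close>.\<close>

lemma dvd_sum_minus_size_mult:
  fixes c k :: int
  assumes "\<And>p. p \<in># P \<Longrightarrow> k dvd p - c"
  shows "k dvd \<Sum>\<^sub># P - int (size P) * c"
  using assms
proof (induction P)
  case (add p P)
  then have "k dvd (p - c) + (\<Sum>\<^sub># P - int (size P) * c)"
    by (intro dvd_add) auto
  then show ?case
    by (simp add: algebra_simps)
qed simp

section \<open>Products of sequences\<close>

text \<open>A relation rather than a function, because different orderings of a sequence may have
  different products.\<close>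

definition (in group) is_product :: "'a multiset \<Rightarrow> 'a \<Rightarrow> bool" where
  "is_product S g \<longleftrightarrow> set_mset S \<subseteq> carrier G \<and> (\<exists>xs. mset xs = S \<and> foldr (\<otimes>) xs \<one> = g)"

context group
begin

lemma product_one_iff_is_product: "product_one G S \<longleftrightarrow> is_product S \<one>"
  unfolding product_one_def is_product_def by simp

lemma is_product_empty: "is_product {#} \<one>"
  unfolding is_product_def by simp

lemma is_product_single: "g \<in> carrier G \<Longrightarrow> is_product {#g#} g"
  unfolding is_product_def by (auto intro!: exI[of _ "[g]"])

lemma is_product_add:
  assumes "is_product S g" "is_product T h"
  shows "is_product (S + T) (g \<otimes> h)"
proof -
  obtain xs ys where xs: "mset xs = S" "foldr (\<otimes>) xs \<one> = g" "set_mset S \<subseteq> carrier G"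
    and ys: "mset ys = T" "foldr (\<otimes>) ys \<one> = h" "set_mset T \<subseteq> carrier G"
    using assms unfolding is_product_def by blast
  have "foldr (\<otimes>) (xs @ ys) \<one> = g \<otimes> h"
    using xs ys by (subst foldr_mult_append) auto
  then show ?thesis
    unfolding is_product_def using xs ys by (intro conjI exI[of _ "xs @ ys"]) auto
qed

lemma is_product_add_single:
  assumes "is_product S g" "h \<in> carrier G"
  shows "is_product (add_mset h S) (g \<otimes> h)"
  using is_product_add[OF assms(1) is_product_single[OF assms(2)]] by simp

lemma is_product_exists:
  assumes "set_mset S \<subseteq> carrier G"
  obtains g where "g \<in> carrier G" "is_product S g"
proof -
  obtain xs where "mset xs = S"
    using ex_mset by blast
  then have "is_product S (foldr (\<otimes>) xs \<one>)" "foldr (\<otimes>) xs \<one> \<in> carrier G"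
    using assms foldr_mult_closed[of xs] unfolding is_product_def by auto
  then show thesis
    using that by blast
qed

end

section \<open>Abelian and cyclic groups\<close>

lemma (in comm_group) is_product_unique:
  assumes "is_product S g" "is_product S h"
  shows "g = h"
proof -
  have "foldr (\<otimes>) xs \<one> = foldr (\<otimes>) ys \<one>"
    if "mset xs = mset ys" "set xs \<subseteq> carrier G" for xs ys
    using that
  proof (induction xs arbitrary: ys)
    case (Cons z xs)
    then obtain us vs where ys: "ys = us @ z # vs"
      by (metis list.set_intros(1) mset_eq_setD split_list)
    moreover have "set ys \<subseteq> carrier G"
      using Cons.prems by (metis mset_eq_setD)
    ultimately have "mset xs = mset (us @ vs)" "set us \<subseteq> carrier G" "set vs \<subseteq> carrier G"
      using Cons.prems(1) by auto
    then show ?case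
      using Cons.IH[of "us @ vs"] Cons.prems
      by (simp add: ys foldr_mult_append foldr_mult_closed m_lcomm del: foldr_append)
  qed simp
  then show ?thesis
    using assms unfolding is_product_def by (metis set_mset_mset)
qed

text \<open>In an abelian group the complement of a product-one subsequence in a product-one
  sequence also has product one, so such a subsequence of \<open>S\<close> would split the minimal
  sequence.\<close>

lemma (in comm_group) minimal_product_one_remove1:
  assumes S: "minimal_product_one G (add_mset g S)"
  shows "product_one_free G S"
proof -
  have prod: "is_product (add_mset g S) \<one>" and closed: "set_mset S \<subseteq> carrier G" "g \<in> carrier G"
    using S unfolding minimal_product_one_def product_one_def is_product_def by auto
  have "T = {#}" if T: "T \<subseteq># S" "product_one G T" for T
  proof (rule ccontr)
    assume "T \<noteq> {#}"
    obtain U where U: "S = T + U"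
      using T(1) by (metis subset_mset.add_diff_inverse)
    obtain h where h: "h \<in> carrier G" "is_product (add_mset g U) h"
      using is_product_exists[of "add_mset g U"] closed U by auto
    have "is_product (T + add_mset g U) (\<one> \<otimes> h)"
      using T(2) h by (intro is_product_add) (auto simp: product_one_iff_is_product)
    then have "\<one> \<otimes> h = \<one>"
      using prod U by (intro is_product_unique) auto
    then have "product_one G (add_mset g U)"
      using h by (simp add: product_one_iff_is_product)
    then show False
      using S T(2) \<open>T \<noteq> {#}\<close> U unfolding minimal_product_one_def
      by (metis add_mset_not_empty union_mset_add_mset_right)
  qed
  then show ?thesis
    using closed unfolding product_one_free_def by auto
qed

text \<open>The general bounds \<open>order G - 1\<close> and \<open>order G\<close> are attained by
  repetitions of a generator.\<close>

lemma (in group) cyclic_group_davenport: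
  assumes fin: "finite (carrier G)" and cyc: "cyclic_group G"
  shows "int (small_davenport G) = int (order G) - 1" "large_davenport G = order G"
    "card (derived G (carrier G)) = 1"
proof -
  interpret comm: comm_group G
    by (rule cyclic_imp_abelian_group[OF cyc])
  obtain y where y: "y \<in> carrier G" "carrier G = range (\<lambda>i :: int. y [^] i)"
    using cyc unfolding cyclic_group by blast
  have ord: "ord y = order G"
    using y(2) cyclic_order_is_ord[OF y(1)] carrier_subgroup_generated_by_singleton[OF y(1)]
    unfolding order_def by simp
  have pos: "0 < order G"
    using fin order_gt_0_iff_finite by blast
  have power: "foldr (\<otimes>) (replicate k y) \<one> = y [^] k" for k
  proof (induction k)
    case (Suc k)
    then show ?case
      using nat_pow_Suc2[OF y(1), of k] by simp
  qed simp
  have pow: "product_one G (replicate_mset k y) \<longleftrightarrow> order G dvd k" for k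
  proof -
    have "is_product (replicate_mset k y) (y [^] k)"
      unfolding is_product_def using y(1) power
      by (intro conjI exI[of _ "replicate k y"]) (auto simp: in_replicate_mset)
    then have "product_one G (replicate_mset k y) \<longleftrightarrow> y [^] k = \<one>"
      unfolding product_one_iff_is_product using comm.is_product_unique by metis
    then show ?thesis
      using pow_eq_id[OF y(1), of k] ord by simp
  qed
  have sub: "\<exists>k. T = replicate_mset k y \<and> k \<le> m" if "T \<subseteq># replicate_mset m y" for T m
    using that by (rule msubseteq_replicate_msetE) blast
  have free: "product_one_free G (replicate_mset (order G - 1) y)"
    unfolding product_one_free_def
  proof (intro conjI notI; (elim exE conjE)?)
    show "set_mset (replicate_mset (order G - 1) y) \<subseteq> carrier G"
      using y(1) by auto
    fix T assume T: "T \<subseteq># replicate_mset (order G - 1) y" "T \<noteq> {#}" "product_one G T"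
    then obtain k where "T = replicate_mset k y" "k \<le> order G - 1"
      using sub by blast
    then show False
      using T(2,3) pow[of k] pos by (auto dest: dvd_imp_le)
  qed
  have minimal: "minimal_product_one G (replicate_mset (order G) y)"
    unfolding minimal_product_one_def
  proof (intro conjI notI; (elim exE conjE)?)
    show "product_one G (replicate_mset (order G) y)"
      unfolding pow by simp
    show "replicate_mset (order G) y = {#} \<Longrightarrow> False"
      using pos by simp
    fix T U assume T: "replicate_mset (order G) y = T + U" "T \<noteq> {#}" "U \<noteq> {#}" "product_one G T"
    then obtain k where k: "T = replicate_mset k y"
      using sub by (metis mset_subset_eq_add_left)
    have "k + size U = order G" "0 < size U"
      using T(1,3) k by (metis size_replicate_mset size_union) (use T(3) in \<open>simp add: nonempty_has_size\<close>)
    then show False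
      using T(2,4) pow[of k] k by (auto dest: dvd_imp_le)
  qed
  have "Max {size S | S. product_one_free G S} = order G - 1"
  proof (rule Max_eqI)
    show "finite {size S | S. product_one_free G S}"
      by (rule finite_product_one_free_sizes[OF fin])
    show "m \<le> order G - 1" if "m \<in> {size S | S. product_one_free G S}" for m
      using that product_one_free_size_less[OF fin] by fastforce
    show "order G - 1 \<in> {size S | S. product_one_free G S}"
      using free by (intro CollectI exI[of _ "replicate_mset (order G - 1) y"]) simp
  qed
  then show "int (small_davenport G) = int (order G) - 1"
    unfolding small_davenport_def using pos by simp
  show "large_davenport G = order G"
    unfolding large_davenport_def
  proof (rule Max_eqI)
    show "finite {size S | S. minimal_product_one G S}"
      by (rule finite_minimal_product_one_sizes[OF fin])
    show "m \<le> order G" if "m \<in> {size S | S. minimal_product_one G S}" for m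
      using that minimal_product_one_size_le[OF fin] by fastforce
    show "order G \<in> {size S | S. minimal_product_one G S}"
      using minimal by (intro CollectI exI[of _ "replicate_mset (order G) y"]) simp
  qed
  show "card (derived G (carrier G)) = 1"
    using comm.derived_eq_singleton[of "carrier G"] by simp
qed

section \<open>Groups with a cyclic subgroup of index two\<close>

text \<open>Exponents are integers that matter only modulo \<open>n\<close>. Finiteness of
  \<open>G\<close> comes from \<open>n_pos\<close> together with
  \<open>carrier_cases\<close>.\<close>

locale cyclic_index_two = group G for G (structure) +
  fixes a x :: 'a and n r s :: int
  assumes a_closed [simp]: "a \<in> carrier G" and x_closed [simp]: "x \<in> carrier G"
    and n_pos: "0 < n"
    and pow_a_eq_one_iff: "a [^] i = \<one> \<longleftrightarrow> n dvd i"
    and x_not_pow: "x \<noteq> a [^] (i :: int)"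
    and carrier_cases: "g \<in> carrier G \<Longrightarrow> \<exists>i :: int. g = a [^] i \<or> g = a [^] i \<otimes> x"
    and x_mult_a: "x \<otimes> a = a [^] r \<otimes> x"
    and x_mult_x: "x \<otimes> x = a [^] s"
begin

definition rot :: "int \<Rightarrow> 'a" where "rot i = a [^] i"

definition flip :: "int \<Rightarrow> 'a" where "flip i = a [^] i \<otimes> x"

lemma rot_closed [simp]: "rot i \<in> carrier G" and flip_closed [simp]: "flip i \<in> carrier G"
  by (simp_all add: rot_def flip_def)

lemma carrier_eq: "carrier G = range rot \<union> range flip"
proof
  show "carrier G \<subseteq> range rot \<union> range flip"
    using carrier_cases unfolding rot_def flip_def by blast
qed auto

lemma x_mult_pow_a: "x \<otimes> a [^] (i :: int) = a [^] (r * i) \<otimes> x"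
proof (induction i rule: int_induct[where k = 0])
  case (step1 i)
  have "x \<otimes> a [^] (i + 1) = x \<otimes> a [^] i \<otimes> a"
    by (simp add: int_pow_mult m_assoc)
  also have "\<dots> = a [^] (r * i) \<otimes> (x \<otimes> a)"
    by (simp add: step1 m_assoc)
  also have "\<dots> = a [^] (r * i) \<otimes> a [^] r \<otimes> x"
    by (simp add: x_mult_a m_assoc)
  also have "\<dots> = a [^] (r * (i + 1)) \<otimes> x"
    by (simp add: int_pow_mult[symmetric] algebra_simps)
  finally show ?case .
next
  case (step2 i)
  \<comment> \<open>The downward step is verified after multiplying by \<open>a\<close> on the
    right, which is cancelled at the end.\<close>
  have "x \<otimes> a [^] (i - 1) \<otimes> a = x \<otimes> a [^] i"
    using int_pow_mult[of a "i - 1" 1] by (simp add: m_assoc)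
  also have "\<dots> = a [^] (r * i) \<otimes> x"
    by (rule step2)
  also have "\<dots> = a [^] (r * (i - 1)) \<otimes> (a [^] r \<otimes> x)"
    by (simp add: m_assoc[symmetric] int_pow_mult[symmetric] algebra_simps)
  also have "\<dots> = a [^] (r * (i - 1)) \<otimes> x \<otimes> a"
    by (simp add: x_mult_a[symmetric] m_assoc)
  finally show ?case
    by simp
qed simp

lemma rot_0 [simp]: "rot 0 = \<one>"
  by (simp add: rot_def)

lemma rot_mult_rot: "rot i \<otimes> rot j = rot (i + j)"
  by (simp add: rot_def int_pow_mult)

lemma rot_mult_flip: "rot i \<otimes> flip j = flip (i + j)"
  by (simp add: rot_def flip_def int_pow_mult m_assoc)

lemma flip_mult_rot: "flip i \<otimes> rot j = flip (i + r * j)"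
  by (simp add: rot_def flip_def m_assoc x_mult_pow_a) (simp add: int_pow_mult m_assoc)

lemma flip_mult_flip: "flip i \<otimes> flip j = rot (i + r * j + s)"
proof -
  have "flip i \<otimes> flip j = a [^] i \<otimes> (x \<otimes> a [^] j) \<otimes> x"
    by (simp add: flip_def m_assoc)
  also have "\<dots> = a [^] i \<otimes> a [^] (r * j) \<otimes> (x \<otimes> x)"
    by (simp add: x_mult_pow_a m_assoc)
  also have "\<dots> = rot (i + r * j + s)"
    by (simp add: x_mult_x rot_def int_pow_mult)
  finally show ?thesis .
qed

lemma rot_eq_iff: "rot i = rot j \<longleftrightarrow> n dvd i - j"
proof -
  have "rot i = rot j \<longleftrightarrow> rot (i - j) \<otimes> rot j = \<one> \<otimes> rot j"
    by (simp add: rot_mult_rot)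
  also have "\<dots> \<longleftrightarrow> rot (i - j) = \<one>"
    by (subst right_cancel) auto
  finally show ?thesis
    by (simp add: rot_def pow_a_eq_one_iff)
qed

lemma rot_eq_one_iff: "rot i = \<one> \<longleftrightarrow> n dvd i"
  by (simp add: rot_def pow_a_eq_one_iff)

lemma flip_eq_iff: "flip i = flip j \<longleftrightarrow> n dvd i - j"
  using rot_eq_iff[of i j] by (simp add: flip_def rot_def)

lemma rot_neq_flip: "rot i \<noteq> flip j"
proof
  assume "rot i = flip j"
  then have "rot (- j) \<otimes> rot i = rot (- j) \<otimes> flip j"
    by simp
  then have "rot (i - j) = x"
    by (simp add: rot_mult_rot rot_mult_flip) (simp add: flip_def)
  then show False
    using x_not_pow unfolding rot_def by metis
qed

text \<open>The square of \<open>x\<close> is a power of \<open>a\<close>, so conjugating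
  \<open>a\<close> twice by \<open>x\<close> has no effect.\<close>

lemma dvd_r_square: "n dvd r * r - 1"
proof -
  have "flip 0 \<otimes> flip 0 \<otimes> rot 1 = flip 0 \<otimes> (flip 0 \<otimes> rot 1)"
    by (simp add: m_assoc)
  then show ?thesis
    unfolding flip_mult_rot flip_mult_flip rot_mult_rot rot_eq_iff
    by (subst (asm) dvd_minus_iff[symmetric]) (simp add: algebra_simps)
qed

text \<open>The reason is that \<open>x\<close> commutes with its own square
  \<open>a [^] s\<close>.\<close>

lemma dvd_r_minus_1_s: "n dvd (r - 1) * s"
proof -
  have "flip 0 \<otimes> (flip 0 \<otimes> flip 0) = flip 0 \<otimes> flip 0 \<otimes> flip 0"
    by (simp add: m_assoc)
  then show ?thesis
    unfolding flip_mult_flip flip_mult_rot rot_mult_flip flip_eq_iff by (simp add: algebra_simps)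
qed

text \<open>\<open>N\<close> is the order of the commutator subgroup, which is generated by \<open>rot (r - 1)\<close>. Modulo \<open>N\<close>,
  the element \<open>x\<close> acts on exponents by inversion.\<close>

definition N :: int where "N = n div gcd n (r - 1)"

lemma N_pos: "0 < N"
  unfolding N_def using n_pos by (simp add: pos_imp_zdiv_pos_iff zdvd_imp_le)

text \<open>With \<open>g = gcd n (r - 1)\<close>, one has \<open>n = g * N\<close> and
  \<open>r - 1 = g * t\<close> where \<open>N\<close> and \<open>t\<close> are coprime, so first
  \<open>g\<close> and then \<open>t\<close> cancels.\<close>

lemma dvd_r_minus_1_mult_iff: "n dvd (r - 1) * z \<longleftrightarrow> N dvd z"
proof -
  let ?g = "gcd n (r - 1)"
  have g: "?g \<noteq> 0"
    using n_pos by auto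
  obtain t where t: "r - 1 = ?g * t"
    by (meson dvdE gcd_dvd2)
  have n: "n = ?g * N"
    unfolding N_def by simp
  have "coprime N t"
    using div_gcd_coprime[of n "r - 1"] g t unfolding N_def
    by (metis gcd_0_right n_pos nonzero_mult_div_cancel_left order_less_irrefl)
  have "n dvd (r - 1) * z \<longleftrightarrow> ?g * N dvd ?g * (t * z)"
    using n t by (metis mult.assoc)
  also have "\<dots> \<longleftrightarrow> N dvd t * z"
    using g dvd_mult_cancel_left[of ?g N "t * z"] by blast
  also have "\<dots> \<longleftrightarrow> N dvd z"
    using \<open>coprime N t\<close> by (simp add: coprime_dvd_mult_right_iff)
  finally show ?thesis .
qed

lemma N_dvd_n: "N dvd n"
  unfolding N_def by (metis dvd_def dvd_div_mult_self gcd_dvd1 mult.commute)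

text \<open>The product of \<open>r - 1\<close> and \<open>r + 1\<close> vanishes modulo
  \<open>n\<close>, and cancelling \<open>r - 1\<close> turns the modulus \<open>n\<close> into
  \<open>N\<close>.\<close>

lemma N_dvd_r_plus_1: "N dvd r + 1"
proof -
  have "(r - 1) * (r + 1) = r * r - 1"
    by (simp add: algebra_simps)
  then show ?thesis
    using dvd_r_square dvd_r_minus_1_mult_iff by metis
qed

lemma N_dvd_s: "N dvd s"
  using dvd_r_minus_1_s dvd_r_minus_1_mult_iff by blast

section \<open>Sequences and their products in terms of exponents\<close>

text \<open>A sequence has many descriptions of this form, since its terms fix the exponents only
  modulo \<open>n\<close>.\<close>

definition seq :: "int multiset \<Rightarrow> int multiset \<Rightarrow> 'a multiset" where
  "seq H K = image_mset rot H + image_mset flip K"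

lemma seq_add: "seq (H + H') (K + K') = seq H K + seq H' K'"
  by (simp add: seq_def)

lemma size_seq [simp]: "size (seq H K) = size H + size K"
  by (simp add: seq_def)

lemma seq_eq_empty_iff [simp]: "seq H K = {#} \<longleftrightarrow> H = {#} \<and> K = {#}"
  by (simp add: seq_def)

lemma seq_closed: "set_mset (seq H K) \<subseteq> carrier G"
  by (auto simp: seq_def)

lemma flip_in_seq_iff: "(\<exists>i. flip i \<in># seq H K) \<longleftrightarrow> K \<noteq> {#}"
proof -
  have "flip i \<notin> rot ` A" for i A
    by (metis imageE rot_neq_flip)
  then show ?thesis
    by (auto simp: seq_def) blast
qed

lemma obtain_seq:
  assumes "set_mset S \<subseteq> carrier G"
  obtains H K where "S = seq H K"
  using assms
proof (induction S arbitrary: thesis)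
  case empty
  show ?case
    by (rule empty(1)[of "{#}" "{#}"]) (simp add: seq_def)
next
  case (add g S)
  obtain H K where HK: "S = seq H K"
    using add by auto
  consider i where "g = rot i" | i where "g = flip i"
    using add.prems(2) carrier_eq by auto
  then show ?case
  proof cases
    case 1
    then show ?thesis
      using add.prems(1)[of "add_mset i H" K] HK by (simp add: seq_def)
  next
    case 2
    then show ?thesis
      using add.prems(1)[of H "add_mset i K"] HK by (simp add: seq_def)
  qed
qed

text \<open>In an ordered product, a rotation contributes its exponent \<open>h\<close> to the product if an even
  number of reflections precede it, and \<open>r * h\<close> otherwise; the reflections contribute \<open>b\<close> and
  \<open>r * b' + s\<close> alternately.\<close>

definition weight :: "int multiset \<Rightarrow> int multiset \<Rightarrow> int multiset \<Rightarrow> int multiset \<Rightarrow> int" where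
  "weight P Q B B' = \<Sum>\<^sub># P + r * \<Sum>\<^sub># Q + \<Sum>\<^sub># B + r * \<Sum>\<^sub># B' + int (size B') * s"

text \<open>The first, third, ... reflections are collected in \<open>B\<close>, the others in
  \<open>B'\<close>; a rotation goes to \<open>Q\<close> exactly when an odd number of reflections
  precede it, which requires \<open>B\<close> to be nonempty.\<close>

lemma is_productD:
  assumes "is_product S g"
  obtains P Q B B' where "S = seq (P + Q) (B + B')" "B = {#} \<Longrightarrow> Q = {#}"
    "size B = size B' \<and> g = rot (weight P Q B B') \<or>
     size B = Suc (size B') \<and> g = flip (weight P Q B B')"
proof -
  obtain xs where "mset xs = S" "foldr (\<otimes>) xs \<one> = g" "set xs \<subseteq> carrier G"
    using assms unfolding is_product_def by auto
  then have "\<exists>P Q B B'. S = seq (P + Q) (B + B') \<and> (B = {#} \<longrightarrow> Q = {#}) \<and>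
    (size B = size B' \<and> g = rot (weight P Q B B') \<or>
     size B = Suc (size B') \<and> g = flip (weight P Q B B'))"
  \<comment> \<open>Terms are appended on the right, because a contribution depends only on the
    reflections before it.\<close>
  proof (induction xs arbitrary: S g rule: rev_induct)
    case Nil
    then show ?case
      by (intro exI[of _ "{#}"]) (simp add: seq_def weight_def)
  next
    case (snoc y ys)
    obtain P Q B B' where IH: "mset ys = seq (P + Q) (B + B')" "B = {#} \<longrightarrow> Q = {#}"
      "size B = size B' \<and> foldr (\<otimes>) ys \<one> = rot (weight P Q B B') \<or>
       size B = Suc (size B') \<and> foldr (\<otimes>) ys \<one> = flip (weight P Q B B')"
      using snoc.IH[OF refl refl] snoc.prems(3) by auto
    have y: "y \<in> carrier G"
      using snoc.prems by auto
    have g: "g = foldr (\<otimes>) ys \<one> \<otimes> y"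
      using snoc.prems y by (subst (asm) foldr_mult_append) auto
    have S: "S = add_mset y (mset ys)"
      using snoc.prems by simp
    consider i where "y = rot i" | i where "y = flip i"
      using y carrier_eq by auto
    then show ?case
    proof cases
      case 1
      show ?thesis
      proof (cases "size B = size B'")
        case True
        then have "g = rot (weight (add_mset i P) Q B B')"
          using IH(3) 1 by (simp add: g rot_mult_rot weight_def add_ac)
        moreover have "S = seq (add_mset i P + Q) (B + B')"
          by (simp add: S IH(1) 1 seq_def)
        ultimately show ?thesis
          using True IH(2) by blast
      next
        case False
        then have B: "size B = Suc (size B')"
          using IH(3) by blast
        then have "g = flip (weight P (add_mset i Q) B B')"
          using IH(3) 1 by (simp add: g flip_mult_rot weight_def algebra_simps)
        moreover have "S = seq (P + add_mset i Q) (B + B')"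
          by (simp add: S IH(1) 1 seq_def)
        moreover have "B \<noteq> {#}"
          using B by auto
        ultimately show ?thesis
          using B by blast
      qed
    next
      case 2
      show ?thesis
      proof (cases "size B = size B'")
        case True
        then have "g = flip (weight P Q (add_mset i B) B')"
          using IH(3) 2 by (simp add: g rot_mult_flip weight_def algebra_simps)
        moreover have "S = seq (P + Q) (add_mset i B + B')"
          by (simp add: S IH(1) 2 seq_def)
        moreover have "size (add_mset i B) = Suc (size B')" "add_mset i B \<noteq> {#}"
          using True by auto
        ultimately show ?thesis
          by blast
      next
        case False
        then have B: "size B = Suc (size B')"
          using IH(3) by blast
        then have "g = rot (weight P Q B (add_mset i B'))"
          using IH(3) 2 by (simp add: g flip_mult_flip weight_def algebra_simps)
        moreover have "S = seq (P + Q) (B + add_mset i B')"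
          by (simp add: S IH(1) 2 seq_def)
        moreover have "size B = size (add_mset i B')" "B \<noteq> {#}"
          using B by auto
        ultimately show ?thesis
          by blast
      qed
    qed
  qed
  then show thesis
    using that by blast
qed

lemma is_product_rots: "is_product (seq P {#}) (rot (\<Sum>\<^sub># P))"
proof (induction P)
  case (add i P)
  then show ?case
    using is_product_add_single[OF add, of "rot i"] by (simp add: seq_def rot_mult_rot add.commute)
qed (simp add: seq_def is_product_empty)

lemma is_product_flips:
  assumes "size B = size B'"
  shows "is_product (seq {#} (B + B')) (rot (weight {#} {#} B B'))"
  using assms
proof (induction B arbitrary: B')
  case empty
  then show ?case
    by (simp add: seq_def weight_def is_product_empty)
next
  case (add b B)
  then obtain b' C where B': "B' = add_mset b' C" "size B = size C"
    by (metis size_Suc_Diff1 size_add_mset diff_Suc_1 insert_DiffM nat.inject size_eq_Suc_imp_elem)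
  have "is_product {#flip b, flip b'#} (flip b \<otimes> flip b')"
    using is_product_add_single[OF is_product_single, of "flip b" "flip b'"]
    by (simp add: add_mset_commute)
  from is_product_add[OF add.IH[OF B'(2)] this]
  show ?case
    by (simp add: seq_def B' rot_mult_rot flip_mult_flip weight_def algebra_simps add_mset_commute)
qed

text \<open>Any balanced distribution is realised: all of \<open>Q\<close> is placed between one
  pair of reflections, the other pairs follow, and \<open>P\<close> comes last.\<close>

lemma is_productI:
  assumes "size B = size B'" "B \<noteq> {#} \<or> Q = {#}"
  shows "is_product (seq (P + Q) (B + B')) (rot (weight P Q B B'))"
proof (cases "B = {#}")
  case True
  then show ?thesis
    using assms is_product_rots[of P] by (simp add: weight_def)
next
  case False
  then obtain b C where B: "B = add_mset b C"
    by (meson multiset_cases)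
  then obtain b' C' where B': "B' = add_mset b' C'" "size C = size C'"
    using assms(1) by (metis size_Suc_Diff1 size_add_mset diff_Suc_1 insert_DiffM nat.inject size_eq_Suc_imp_elem)
  have 1: "is_product (add_mset (flip b') (add_mset (flip b) (seq Q {#}))) (flip b \<otimes> rot (\<Sum>\<^sub># Q) \<otimes> flip b')"
    using is_product_add_single[OF is_product_add[OF is_product_single[of "flip b"] is_product_rots[of Q]], of "flip b'"]
    by simp
  have "is_product (add_mset (flip b') (add_mset (flip b) (seq Q {#})) + seq {#} (C + C') + seq P {#})
     (flip b \<otimes> rot (\<Sum>\<^sub># Q) \<otimes> flip b' \<otimes> rot (weight {#} {#} C C') \<otimes> rot (\<Sum>\<^sub># P))"
    by (intro is_product_add 1 is_product_flips is_product_rots B')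
  moreover have "add_mset (flip b') (add_mset (flip b) (seq Q {#})) + seq {#} (C + C') + seq P {#} =
      seq (P + Q) (B + B')"
    by (simp add: B B' seq_def)
  moreover have "flip b \<otimes> rot (\<Sum>\<^sub># Q) \<otimes> flip b' \<otimes> rot (weight {#} {#} C C') \<otimes> rot (\<Sum>\<^sub># P) =
      rot (weight P Q B B')"
    by (simp add: B B' flip_mult_rot flip_mult_flip rot_mult_rot weight_def algebra_simps)
  ultimately show ?thesis
    by simp
qed

lemma is_product_congI:
  assumes "size B = size B'" "B \<noteq> {#} \<or> Q = {#}" "n dvd weight P Q B B' - v"
    "S = seq (P + Q) (B + B')"
  shows "is_product S (rot v)"
  using is_productI[OF assms(1,2), of P] assms(3,4) by (metis rot_eq_iff)

lemma is_product_rotD: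
  assumes "is_product S (rot v)"
  obtains P Q B B' where "S = seq (P + Q) (B + B')" "size B = size B'" "n dvd weight P Q B B' - v"
    "B = {#} \<Longrightarrow> Q = {#}"
proof -
  obtain P Q B B' where "S = seq (P + Q) (B + B')" "size B = size B'" "rot v = rot (weight P Q B B')"
    "B = {#} \<Longrightarrow> Q = {#}"
    using is_productD[OF assms] by (metis rot_neq_flip)
  then show thesis
    using that[of P Q B B'] by (metis rot_eq_iff)
qed

text \<open>Modulo \<open>n\<close>, exchanging the two sides multiplies the weight by
  \<open>r\<close>, because \<open>r * r = 1\<close> and \<open>r * s = s\<close>. A multiple
  \<open>v\<close> of \<open>N\<close> satisfies \<open>r * v = v\<close> modulo
  \<open>n\<close>.\<close>

lemma weight_swap:
  assumes eq: "size B = size B'" and "n dvd weight P Q B B' - v" "N dvd v"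
  shows "n dvd weight Q P B' B - v"
proof -
  have "weight Q P B' B - v = r * (weight P Q B B' - v) + (r - 1) * v
      - (r * r - 1) * (\<Sum>\<^sub># Q + \<Sum>\<^sub># B') - (r - 1) * s * int (size B)"
    by (simp add: weight_def eq algebra_simps)
  then show ?thesis
    using assms dvd_r_minus_1_s dvd_r_square
    by (simp add: dvd_r_minus_1_mult_iff)
qed

section \<open>Upper bound for minimal product-one sequences\<close>

text \<open>Here \<open>rot v\<close> is a product of \<open>S\<close>. The remainder must keep a
  reflection so that the splitting can be iterated.\<close>

definition splits_off :: "'a multiset \<Rightarrow> int \<Rightarrow> 'a multiset \<Rightarrow> int \<Rightarrow> 'a multiset \<Rightarrow> bool" where
  "splits_off S v T u S' \<longleftrightarrow> S = T + S' \<and> T \<noteq> {#} \<and> N dvd u \<and> is_product T (rot u) \<and>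
     is_product S' (rot (v - u)) \<and> (\<exists>i. flip i \<in># S')"

lemma N_dvd_r_minus_minus_1: "N dvd r * z + z"
  using N_dvd_r_plus_1 by (metis dvd_mult2 distrib_right mult_1)

lemma splits_offI:
  assumes "S = T + seq H K" "K \<noteq> {#}" "T \<noteq> {#}" "N dvd u" "is_product T (rot u)"
    "is_product (seq H K) (rot (v - u))"
  shows "splits_off S v T u (seq H K)"
  using assms flip_in_seq_iff unfolding splits_off_def by simp

text \<open>Rotations in \<open>P\<close> contribute their exponents unchanged, so removing
  \<open>I\<close> lowers the weight by exactly its sum.\<close>

lemma splits_off_P:
  assumes conf: "S = seq (P + Q) (B + B')" "size B = size B'" "B \<noteq> {#}" "n dvd weight P Q B B' - v"
    and I: "I \<subseteq># P" "I \<noteq> {#}" "N dvd \<Sum>\<^sub># I"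
  shows "splits_off S v (seq I {#}) (\<Sum>\<^sub># I) (seq (P - I + Q) (B + B'))"
proof -
  obtain P' where P: "P = I + P'"
    using I(1) by (metis subset_mset.add_diff_inverse)
  have "is_product (seq (P' + Q) (B + B')) (rot (v - \<Sum>\<^sub># I))"
    by (rule is_product_congI[of B B' Q P']) (use conf in \<open>auto simp: P weight_def algebra_simps\<close>)
  then show ?thesis
    using conf I is_product_rots[of I] by (intro splits_offI) (auto simp: P seq_def)
qed

text \<open>The product of the pair has exponent \<open>b + r * b' + s\<close>, which is
  \<open>b - b'\<close> modulo \<open>N\<close>. Removing one reflection of each sign keeps the rest
  balanced, and \<open>2 <= size B\<close> keeps it from losing all reflections.\<close>

lemma splits_off_congruent_pair:
  assumes conf: "S = seq (P + Q) (B + B')" "size B = size B'" "2 \<le> size B" "n dvd weight P Q B B' - v"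
    and b: "b \<in># B" "b' \<in># B'" "N dvd b - b'"
  shows "\<exists>T u S'. splits_off S v T u S' \<and> size T = 2"
proof -
  obtain C C' where C: "B = add_mset b C" "B' = add_mset b' C'"
    using b by (metis insert_DiffM)
  have sz: "size C = size C'" "C \<noteq> {#}"
    using conf(2,3) C by auto
  let ?u = "weight {#} {#} {#b#} {#b'#}"
  have "?u = (b - b') + (r * b' + b') + s"
    by (simp add: weight_def)
  then have u: "N dvd ?u"
    using b(3) N_dvd_s N_dvd_r_minus_minus_1 by (simp only: dvd_add)
  have "is_product (seq {#} ({#b#} + {#b'#})) (rot ?u)"
    by (rule is_product_flips) simp
  moreover have "is_product (seq (P + Q) (C + C')) (rot (v - ?u))"
    by (rule is_product_congI[of C C' Q P]) (use conf sz in \<open>auto simp: C weight_def algebra_simps\<close>)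
  ultimately have "splits_off S v (seq {#} ({#b#} + {#b'#})) ?u (seq (P + Q) (C + C'))"
    using conf(1) sz u by (intro splits_offI) (auto simp: C seq_def)
  then show ?thesis
    by (intro exI conjI) auto
qed

text \<open>By \<open>weight_swap\<close> the side with more rotations can be taken as
  \<open>P\<close>.\<close>

lemma obtain_balanced:
  assumes "is_product S (rot v)" "\<exists>i. flip i \<in># S" "N dvd v"
  obtains P Q B B' where "S = seq (P + Q) (B + B')" "size B = size B'" "B \<noteq> {#}"
    "n dvd weight P Q B B' - v" "size Q \<le> size P"
proof -
  obtain P Q B B' where conf: "S = seq (P + Q) (B + B')" "size B = size B'" "n dvd weight P Q B B' - v"
    using is_product_rotD[OF assms(1)] .
  have ne: "B \<noteq> {#}" "B' \<noteq> {#}"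
    using assms(2) conf(1,2) flip_in_seq_iff by auto
  show thesis
  proof (cases "size Q \<le> size P")
    case True
    then show ?thesis
      using that conf ne by blast
  next
    case False
    then show ?thesis
      using that[of Q P B' B] conf ne weight_swap[OF conf(2,3) assms(3)] by (auto simp: add.commute)
  qed
qed

text \<open>This produces the last block, whose length is not controlled. One pair \<open>b\<close>,
  \<open>b'\<close> is held back so that the remainder keeps reflections and can still accommodate
  \<open>Q\<close>.\<close>

lemma splits_off_of_size:
  assumes S: "is_product S (rot v)" "\<exists>i. flip i \<in># S" "N dvd v" and size: "2 * N < int (size S)"
  shows "\<exists>T u S'. splits_off S v T u S'"
proof -
  obtain P Q B B' where conf: "S = seq (P + Q) (B + B')" "size B = size B'" "B \<noteq> {#}"
    "n dvd weight P Q B B' - v" "size Q \<le> size P"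
    using obtain_balanced[OF S] .
  obtain b C where C: "B = add_mset b C"
    using conf(3) by (meson multiset_cases)
  obtain b' C' where C': "B' = add_mset b' C'"
    using conf(2,3) by (metis multiset_cases size_empty size_eq_0_iff_empty)
  \<comment> \<open>As \<open>size Q <= size P\<close>, twice \<open>size C + 1 + size P\<close> is
    at least \<open>size S\<close>, which exceeds \<open>2 * N\<close>.\<close>
  have sz: "size C = size C'" "N \<le> int (size C + size P)"
    using conf(2,5) size by (auto simp: C C' conf(1))
  obtain U U' J where U: "U \<subseteq># C" "U' \<subseteq># C'" "J \<subseteq># P" "size U = size U'"
    "U \<noteq> {#} \<or> J \<noteq> {#}" "N dvd (\<Sum>\<^sub># U - \<Sum>\<^sub># U' + \<Sum>\<^sub># J)"
    using zero_sum_pairs_singles[OF N_pos sz] .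
  obtain D D' K where D: "C = U + D" "C' = U' + D'" "P = J + K"
    using U(1-3) by (metis subset_mset.add_diff_inverse)
  let ?u = "weight J {#} U U'"
  have "?u = (\<Sum>\<^sub># U - \<Sum>\<^sub># U' + \<Sum>\<^sub># J) + (r * \<Sum>\<^sub># U' + \<Sum>\<^sub># U') + int (size U') * s"
    by (simp add: weight_def)
  then have u: "N dvd ?u"
    using U(6) N_dvd_s N_dvd_r_minus_minus_1 by (simp only: dvd_add dvd_mult)
  have "is_product (seq (J + {#}) (U + U')) (rot ?u)"
    by (rule is_productI) (use U in auto)
  moreover have "is_product (seq (K + Q) (add_mset b D + add_mset b' D')) (rot (v - ?u))"
    by (rule is_product_congI[of "add_mset b D" "add_mset b' D'" Q K])
      (use conf sz U(4) in \<open>auto simp: C C' D weight_def algebra_simps\<close>)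
  ultimately have "splits_off S v (seq (J + {#}) (U + U')) ?u (seq (K + Q) (add_mset b D + add_mset b' D'))"
    using conf(1) U(5) u by (intro splits_offI) (auto simp: C C' D seq_def)
  then show ?thesis
    by blast
qed

text \<open>The reflections in \<open>B - F\<close> or those in \<open>B' - F'\<close> represent all residues of \<open>F\<close> or \<open>F'\<close>. Hence
  exchanging \<open>U \<subseteq> F\<close> and \<open>U' \<subseteq> F'\<close> puts congruent reflections on opposite sides.\<close>

lemma splits_off_by_exchange:
  assumes conf: "S = seq (P + Q) (B + B')" "size B = size B'" "2 \<le> size B" "n dvd weight P Q B B' - v"
    and N: "2 \<le> N" and F: "F \<subseteq># B" "F' \<subseteq># B'" "size F = size F'" "N \<le> int (size F + size P)"
    and P: "int (size P) \<le> N"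
    and reps: "(\<forall>b\<in>#F. \<exists>c\<in>#B - F. N dvd c - b) \<or> (\<forall>b\<in>#F'. \<exists>c\<in>#B' - F'. N dvd b - c)"
  shows "\<exists>T u S'. splits_off S v T u S' \<and> int (size T) \<le> N"
proof -
  have N0: "0 < N"
    using N by simp
  obtain U U' J where U: "U \<subseteq># F" "U' \<subseteq># F'" "J \<subseteq># P" "size U = size U'"
    "U \<noteq> {#} \<or> J \<noteq> {#}" "N dvd (\<Sum>\<^sub># U - \<Sum>\<^sub># U' + \<Sum>\<^sub># J)"
    using zero_sum_pairs_singles[OF N0 F(3,4)] .
  show ?thesis
  proof (cases "U = {#}")
    \<comment> \<open>Only rotations were selected, and they form a block without any
      exchange.\<close>
    case True
    then have "splits_off S v (seq J {#}) (\<Sum>\<^sub># J) (seq (P - J + Q) (B + B'))"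
      using conf U by (intro splits_off_P) auto
    moreover have "int (size (seq J {#})) \<le> N"
      using U(3) P size_mset_mono[of J P] by simp
    ultimately show ?thesis
      by blast
  next
    case False
    then have False': "U' \<noteq> {#}"
      using U(4) by auto
    obtain D D' K where D: "F = U + D" "F' = U' + D'" "P = J + K"
      using U(1-3) by (metis subset_mset.add_diff_inverse)
    obtain E E' where E: "B = F + E" "B' = F' + E'"
      using F(1,2) by (metis subset_mset.add_diff_inverse)
    let ?B = "U' + D + E" and ?B' = "U + D' + E'"
    have sz: "size ?B = size B" "size ?B = size ?B'"
      using conf(2) U(4) D E by auto
    \<comment> \<open>Moving a term from sign \<open>+\<close> to the other side multiplies its
      contribution by \<open>r\<close>. The total change is \<open>r - 1\<close> times a multiple of
      \<open>N\<close>, hence zero modulo \<open>n\<close>.\<close>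
    have "weight K (J + Q) ?B ?B' - v =
        (weight P Q B B' - v) + (r - 1) * (\<Sum>\<^sub># U - \<Sum>\<^sub># U' + \<Sum>\<^sub># J)"
      using U(4) by (simp add: D E weight_def algebra_simps)
    then have w: "n dvd weight K (J + Q) ?B ?B' - v"
      using conf(4) U(6) by (simp only: dvd_add dvd_r_minus_1_mult_iff)
    \<comment> \<open>An element of \<open>U\<close> now faces its representative in
      \<open>E\<close>, or an element of \<open>U'\<close> faces its representative in
      \<open>E'\<close>.\<close>
    have "\<exists>b b'. b \<in># ?B \<and> b' \<in># ?B' \<and> N dvd b - b'"
    proof -
      obtain b b' where "b \<in># U" "b' \<in># U'"
        using False False' by (meson multiset_nonemptyE)
      then show ?thesis
        using reps by (auto simp: D E)
    qed
    then obtain b b' where b: "b \<in># ?B" "b' \<in># ?B'" "N dvd b - b'"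
      by blast
    have "S = seq (K + (J + Q)) (?B + ?B')"
      by (simp add: conf(1) D E ac_simps)
    then show ?thesis
      using splits_off_congruent_pair[OF _ sz(2) _ w b] conf(3) sz(1) N by fastforce
  qed
qed

text \<open>The bound \<open>3 * N\<close> gives \<open>size B + size P > 3 * N / 2\<close>, so
  after holding back at most \<open>N / 2\<close> representatives there are still \<open>N\<close>
  pairs and rotations for the exchange.\<close>

lemma splits_off_small:
  assumes S: "is_product S (rot v)" "\<exists>i. flip i \<in># S" "N dvd v"
    and size: "3 * N < int (size S)" and N: "2 \<le> N"
  shows "\<exists>T u S'. splits_off S v T u S' \<and> int (size T) \<le> N"
proof -
  obtain P Q B B' where conf: "S = seq (P + Q) (B + B')" "size B = size B'" "B \<noteq> {#}"
    "n dvd weight P Q B B' - v" "size Q \<le> size P"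
    using obtain_balanced[OF S] .
  show ?thesis
  proof (cases "N \<le> int (size P)")
    case True
    then obtain I where I: "I \<subseteq># P" "I \<noteq> {#}" "int (size I) \<le> N" "N dvd \<Sum>\<^sub># I"
      using zero_sum_submultiset[OF N_pos, of P "\<lambda>i. i"] by auto
    then show ?thesis
      using splits_off_P[OF conf(1-4) I(1,2,4)] by (intro exI conjI) auto
  next
    case False
    define res where "res M = (\<lambda>b. b mod N) ` set_mset M" for M
    \<comment> \<open>Since \<open>size P < N\<close>, more than \<open>N / 2\<close> reflections
      are in \<open>B\<close>.\<close>
    have B2: "2 \<le> size B"
      using size False conf(1,2,5) N by auto
    show ?thesis
    proof (cases "res B \<inter> res B' = {}")
      case False
      then obtain b b' where "b \<in># B" "b' \<in># B'" "b mod N = b' mod N"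
        unfolding res_def by auto
      then show ?thesis
        using splits_off_congruent_pair[OF conf(1,2) B2 conf(4)] N by (metis mod_eq_dvd_iff of_nat_numeral)
    next
      case True
      have fin: "finite (res M)" "res M \<subseteq> {0..<N}" for M
        using N_pos unfolding res_def by auto
      have "card (res B) + card (res B') = card (res B \<union> res B')"
        using True fin by (simp add: card_Un_disjoint)
      also have "\<dots> \<le> card {0..<N}"
        by (rule card_mono) (use fin in auto)
      finally have "int (card (res B) + card (res B')) \<le> N"
        using N_pos by simp
      then consider "2 * int (card (res B)) \<le> N" | "2 * int (card (res B')) \<le> N"
        by linarith
      then show ?thesis
      proof cases
        case 1
        obtain R where R: "R \<subseteq># B" "size R = card (res B)" "\<And>b. b \<in># B \<Longrightarrow> \<exists>c\<in>#R. c mod N = b mod N"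
          using residue_representatives[OF N_pos, of B] unfolding res_def by metis
        have "size (B - R) \<le> size B'"
          using R(1) conf(2) by (simp add: size_Diff_submset)
        then obtain F' where F': "F' \<subseteq># B'" "size F' = size (B - R)"
          by (rule obtain_submultiset_of_size)
        have "size R \<le> size B"
          using R(1) by (rule size_mset_mono)
        have BR: "B - (B - R) = R"
          using R(1) by (metis add_diff_cancel_left' subset_mset.diff_add)
        show ?thesis
        proof (rule splits_off_by_exchange[OF conf(1,2) B2 conf(4) N])
          show "B - R \<subseteq># B" "F' \<subseteq># B'" "size (B - R) = size F'" "int (size P) \<le> N"
            using F' False by auto
          show "N \<le> int (size (B - R) + size P)"
            using size R 1 conf(1,2,5) \<open>size R \<le> size B\<close> by (auto simp: size_Diff_submset of_nat_diff)
          show "(\<forall>b\<in>#B - R. \<exists>c\<in>#B - (B - R). N dvd c - b) \<or>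
              (\<forall>b\<in>#F'. \<exists>c\<in>#B' - F'. N dvd b - c)"
            unfolding BR using R(3) by (meson in_diffD mod_eq_dvd_iff)
        qed
      next
        case 2
        obtain R where R: "R \<subseteq># B'" "size R = card (res B')" "\<And>b. b \<in># B' \<Longrightarrow> \<exists>c\<in>#R. c mod N = b mod N"
          using residue_representatives[OF N_pos, of B'] unfolding res_def by metis
        have "size (B' - R) \<le> size B"
          using R(1) conf(2) by (simp add: size_Diff_submset)
        then obtain F where F: "F \<subseteq># B" "size F = size (B' - R)"
          by (rule obtain_submultiset_of_size)
        have "size R \<le> size B'"
          using R(1) by (rule size_mset_mono)
        have BR: "B' - (B' - R) = R"
          using R(1) by (metis add_diff_cancel_left' subset_mset.diff_add)
        show ?thesis
        proof (rule splits_off_by_exchange[OF conf(1,2) B2 conf(4) N])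
          show "B' - R \<subseteq># B'" "F \<subseteq># B" "size F = size (B' - R)" "int (size P) \<le> N"
            using F False by auto
          show "N \<le> int (size F + size P)"
            using size R 2 conf(1,2,5) \<open>size R \<le> size B'\<close> F(2) by (auto simp: size_Diff_submset of_nat_diff)
          show "(\<forall>b\<in>#F. \<exists>c\<in>#B - F. N dvd c - b) \<or>
              (\<forall>b\<in>#B' - R. \<exists>c\<in>#B' - (B' - R). N dvd b - c)"
            unfolding BR using R(3) by (metis in_diffD mod_eq_dvd_iff)
        qed
      qed
    qed
  qed
qed

section \<open>Combining blocks into product-one sequences\<close>

text \<open>The pair records one chosen product \<open>rot u\<close>, as a sequence may have
  several. The modulus \<open>k\<close> will be \<open>N\<close> or \<open>2\<close>.\<close>

definition block :: "int \<Rightarrow> 'a multiset \<times> int \<Rightarrow> bool" where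
  "block k = (\<lambda>(T, u). T \<noteq> {#} \<and> k dvd u \<and> is_product T (rot u))"

lemma is_product_blocks:
  assumes "\<And>p. p \<in># Z \<Longrightarrow> block k p"
  shows "is_product (\<Sum>\<^sub># (image_mset fst Z)) (rot (\<Sum>\<^sub># (image_mset snd Z)))"
  using assms
proof (induction Z)
  case (add p Z)
  then have "is_product (fst p) (rot (snd p))"
    unfolding block_def by (auto split: prod.splits)
  from is_product_add[OF this add.IH] show ?case
    using add.prems by (simp add: rot_mult_rot)
qed (simp add: is_product_empty)

text \<open>Divided by \<open>k\<close>, the exponents are \<open>n / k\<close> integers, and some
  of them sum to zero modulo \<open>n / k\<close>.\<close>

lemma zero_sum_blocks:
  assumes "\<And>p. p \<in># Z \<Longrightarrow> block k p" and n: "n = k * int (size Z)"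
  obtains I where "I \<subseteq># Z" "\<Sum>\<^sub># (image_mset fst I) \<noteq> {#}" "n dvd \<Sum>\<^sub># (image_mset snd I)"
proof -
  have "k * int (size Z) \<noteq> 0"
    using n n_pos by linarith
  then have k: "k \<noteq> 0" "0 < int (size Z)"
    by auto
  obtain I where I: "I \<subseteq># Z" "I \<noteq> {#}" "int (size Z) dvd (\<Sum>p\<in>#I. snd p div k)"
    using zero_sum_submultiset[OF k(2), of Z "\<lambda>p. snd p div k"] by auto
  have blk: "block k p" if "p \<in># I" for p
    by (rule assms(1)) (rule mset_subset_eqD[OF I(1) that])
  have "\<Sum>\<^sub># (image_mset snd I) = k * (\<Sum>p\<in>#I. snd p div k)"
  proof -
    have "image_mset snd I = image_mset (\<lambda>p. k * (snd p div k)) I"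
      by (rule image_mset_cong) (use blk in \<open>auto simp: block_def\<close>)
    then show ?thesis
      by (simp add: sum_mset_distrib_left)
  qed
  then have "n dvd \<Sum>\<^sub># (image_mset snd I)"
    using I(3) n by simp
  moreover obtain p where "p \<in># I"
    using I(2) by (meson multiset_nonemptyE)
  then have "\<Sum>\<^sub># (image_mset fst I) \<noteq> {#}"
    using blk[of p] unfolding block_def by (auto dest!: multi_member_split)
  ultimately show thesis
    using that I(1) by blast
qed

text \<open>Every block but the last takes at most \<open>N\<close> terms, from a sequence with more
  than \<open>3 * N\<close>; the last is taken from one with more than \<open>2 * N\<close>.\<close>

lemma splits_off_blocks:
  assumes N: "2 \<le> N"
  shows "is_product S (rot v) \<Longrightarrow> \<exists>i. flip i \<in># S \<Longrightarrow> N dvd v \<Longrightarrow>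
    N * (int g + 2) < int (size S) \<Longrightarrow>
    \<exists>Z S'. size Z = Suc g \<and> (\<forall>p\<in>#Z. block N p) \<and> S = \<Sum>\<^sub># (image_mset fst Z) + S' \<and> S' \<noteq> {#} \<and>
      is_product S' (rot (v - \<Sum>\<^sub># (image_mset snd Z)))"
proof (induction g arbitrary: S v)
  case 0
  then obtain T u S' where "splits_off S v T u S'"
    using splits_off_of_size[of S v] by auto
  then show ?case
    by (intro exI[of _ "{#(T, u)#}"] exI[of _ S']) (auto simp: splits_off_def block_def)
next
  case (Suc g)
  have "N * (int g + 3) \<ge> N * 3"
    using N by (intro mult_left_mono) auto
  then have "3 * N < int (size S)"
    using Suc.prems(4) by (simp add: algebra_simps)
  then obtain T u S' where T: "splits_off S v T u S'" "int (size T) \<le> N"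
    using splits_off_small[OF Suc.prems(1-3) _ N] by auto
  have "N * (int g + 2) < int (size S')" "N dvd v - u"
    using T Suc.prems(3,4) unfolding splits_off_def by (auto simp: algebra_simps)
  then obtain Z S'' where Z: "size Z = Suc g" "\<forall>p\<in>#Z. block N p" "S' = \<Sum>\<^sub># (image_mset fst Z) + S''"
    "S'' \<noteq> {#}" "is_product S'' (rot (v - u - \<Sum>\<^sub># (image_mset snd Z)))"
    using Suc.IH[of S' "v - u"] T unfolding splits_off_def by auto
  then show ?case
    using T by (intro exI[of _ "add_mset (T, u) Z"] exI[of _ S''])
      (auto simp: splits_off_def block_def algebra_simps)
qed

lemma minimal_product_one_size_bound:
  assumes N: "2 \<le> N" and S: "minimal_product_one G S"
  shows "int (size S) \<le> n + N"
proof (rule ccontr)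
  assume large: "\<not> int (size S) \<le> n + N"
  have prod: "is_product S (rot 0)"
    using S unfolding minimal_product_one_def product_one_iff_is_product by simp
  have split: "T = {#} \<or> U = {#}"
    if "S = T + U" "is_product T (rot u)" "is_product U (rot w)" "n dvd u" "n dvd w" for T U u w
  proof -
    have "rot u = \<one>" "rot w = \<one>"
      using that by (simp_all add: rot_eq_one_iff)
    then show ?thesis
      using S that unfolding minimal_product_one_def product_one_iff_is_product by metis
  qed
  obtain g where g: "n = N * g"
    using N_dvd_n by blast
  then have "0 < g"
    using N n_pos zero_less_mult_pos by (metis N_pos)
  then obtain k where k: "g = int (Suc k)"
    by (metis Suc_pred' pos_int_cases)
  show False
  proof (cases "\<exists>i. flip i \<in># S")
    case True
    \<comment> \<open>Here \<open>k + 1 = n / N\<close>, so the left side is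
      \<open>n + N\<close>.\<close>
    have "N * (int k + 2) < int (size S)"
      using large k g by (simp add: algebra_simps)
    then obtain Z S' where Z: "size Z = Suc k" "\<forall>p\<in>#Z. block N p" "S = \<Sum>\<^sub># (image_mset fst Z) + S'"
      "S' \<noteq> {#}" "is_product S' (rot (0 - \<Sum>\<^sub># (image_mset snd Z)))"
      using splits_off_blocks[OF N prod True dvd_0_right] by blast
    obtain I where I: "I \<subseteq># Z" "\<Sum>\<^sub># (image_mset fst I) \<noteq> {#}" "n dvd \<Sum>\<^sub># (image_mset snd I)"
      using zero_sum_blocks[of Z N] Z g k by metis
    obtain J where J: "Z = I + J"
      using I(1) by (metis subset_mset.add_diff_inverse)
    \<comment> \<open>This exponent is minus the exponent sum over \<open>I\<close>, so the
      complement of the selected blocks has product one too.\<close>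
    have "is_product (\<Sum>\<^sub># (image_mset fst J) + S')
        (rot (\<Sum>\<^sub># (image_mset snd J) + (0 - \<Sum>\<^sub># (image_mset snd Z))))"
      unfolding rot_mult_rot[symmetric] using Z J
      by (intro is_product_add is_product_blocks[of _ N]) auto
    moreover have "is_product (\<Sum>\<^sub># (image_mset fst I)) (rot (\<Sum>\<^sub># (image_mset snd I)))"
      using Z J by (intro is_product_blocks[of _ N]) auto
    moreover have "S = \<Sum>\<^sub># (image_mset fst I) + (\<Sum>\<^sub># (image_mset fst J) + S')"
      using Z(3) J by (simp add: add.assoc)
    ultimately show False
      using split I Z(4) J by fastforce
  next
    case False
    obtain P Q B B' where conf: "S = seq (P + Q) (B + B')" "size B = size B'" "n dvd weight P Q B B' - 0"
      "B = {#} \<Longrightarrow> Q = {#}"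
      using is_product_rotD[OF prod] by blast
    have "B + B' = {#}"
      using False conf(1) flip_in_seq_iff by blast
    then have H: "S = seq P {#}" "n dvd \<Sum>\<^sub># P"
      using conf by (auto simp: weight_def)
    \<comment> \<open>Holding back one rotation leaves at least \<open>n\<close> others, which
      contain a zero-sum part; the complement is nonempty because of \<open>h\<close>.\<close>
    obtain h H' where h: "P = add_mset h H'"
      using H large n_pos N by (cases P) (auto simp: seq_def)
    have "n \<le> int (size H')"
      using large H h N by simp
    then obtain I where I: "I \<subseteq># H'" "I \<noteq> {#}" "n dvd \<Sum>\<^sub># I"
      using zero_sum_submultiset[OF n_pos, of H' "\<lambda>i. i"] by auto
    obtain J where J: "H' = I + J"
      using I(1) by (metis subset_mset.add_diff_inverse)
    have "\<Sum>\<^sub># P = \<Sum>\<^sub># (add_mset h J) + \<Sum>\<^sub># I"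
      by (simp add: h J)
    then have "n dvd \<Sum>\<^sub># (add_mset h J)"
      using I(3) H(2) by (metis dvd_add_left_iff)
    then show False
      using split[of "seq I {#}" "seq (add_mset h J) {#}" "\<Sum>\<^sub># I" "\<Sum>\<^sub># (add_mset h J)"] I h H J
        is_product_rots[of I] is_product_rots[of "add_mset h J"] by (simp add: seq_def)
  qed
qed

section \<open>Upper bound for product-one free sequences\<close>

text \<open>Blocks are removed greedily. Only the last one, for which \<open>l\<close> terms must
  remain, may be longer than \<open>m\<close>.\<close>

lemma obtain_blocks:
  assumes final: "\<And>V. set_mset V \<subseteq> carrier G \<Longrightarrow> l \<le> size V \<Longrightarrow> \<exists>T u. T \<subseteq># V \<and> block k (T, u)"
    and step: "\<And>V. set_mset V \<subseteq> carrier G \<Longrightarrow> l + m \<le> size V \<Longrightarrow>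
      \<exists>T u. T \<subseteq># V \<and> block k (T, u) \<and> size T \<le> m"
  shows "set_mset V \<subseteq> carrier G \<Longrightarrow> l + m * g \<le> size V \<Longrightarrow>
    \<exists>Z. size Z = Suc g \<and> (\<forall>p\<in>#Z. block k p) \<and> \<Sum>\<^sub># (image_mset fst Z) \<subseteq># V"
proof (induction g arbitrary: V)
  case 0
  then obtain T u where "T \<subseteq># V" "block k (T, u)"
    using final[of V] by auto
  then show ?case
    by (intro exI[of _ "{#(T, u)#}"]) auto
next
  case (Suc g)
  then obtain T u where T: "T \<subseteq># V" "block k (T, u)" "size T \<le> m"
    using step[of V] by auto
  obtain W where W: "V = T + W"
    using T(1) by (metis subset_mset.add_diff_inverse)
  obtain Z where "size Z = Suc g" "\<forall>p\<in>#Z. block k p" "\<Sum>\<^sub># (image_mset fst Z) \<subseteq># W"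
    using Suc.IH[of W] Suc.prems T(3) by (auto simp: W)
  then show ?case
    using T(2) by (intro exI[of _ "add_mset (T, u) Z"]) (auto simp: W)
qed

lemma not_product_one_free_if_blocks:
  assumes Z: "\<And>p. p \<in># Z \<Longrightarrow> block k p" "\<Sum>\<^sub># (image_mset fst Z) \<subseteq># V" and n: "n = k * int (size Z)"
  shows "\<not> product_one_free G V"
proof -
  obtain I where I: "I \<subseteq># Z" "\<Sum>\<^sub># (image_mset fst I) \<noteq> {#}" "n dvd \<Sum>\<^sub># (image_mset snd I)"
    using zero_sum_blocks[OF Z(1) n] by blast
  obtain J where J: "Z = I + J"
    using I(1) by (metis subset_mset.add_diff_inverse)
  have "is_product (\<Sum>\<^sub># (image_mset fst I)) (rot (\<Sum>\<^sub># (image_mset snd I)))"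
    using Z(1) J by (intro is_product_blocks[of _ k]) auto
  then have "product_one G (\<Sum>\<^sub># (image_mset fst I))"
    unfolding product_one_iff_is_product using I(3) rot_eq_one_iff by metis
  moreover have "\<Sum>\<^sub># (image_mset fst I) \<subseteq># V"
    using Z(2) J by (metis image_mset_union mset_subset_eq_add_left subset_mset.order_trans sum_mset.union)
  ultimately show ?thesis
    using I(2) unfolding product_one_free_def by blast
qed

lemma block_single_rot: "k dvd h \<Longrightarrow> block k ({#rot h#}, h)"
  by (simp add: block_def is_product_single)

lemma is_product_two_flips: "is_product {#flip b, flip b'#} (rot (b + r * b' + s))"
  using is_product_flips[of "{#b#}" "{#b'#}"] by (simp add: seq_def weight_def add_mset_commute)

lemma seq_mono: "H' \<subseteq># H \<Longrightarrow> K' \<subseteq># K \<Longrightarrow> seq H' K' \<subseteq># seq H K"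
  unfolding seq_def by (intro subset_mset.add_mono image_mset_subseteq_mono)

text \<open>If \<open>n\<close> and \<open>s\<close> are even, then \<open>G\<close> modulo the even rotations is the Klein four-group.\<close>

lemma even_block:
  assumes ev: "even n" "even s" and V: "set_mset V \<subseteq> carrier G" "3 \<le> size V"
  shows "\<exists>T u. T \<subseteq># V \<and> block 2 (T, u) \<and> (size T \<le> 2 \<or> size V = 3)"
proof -
  have "even (r * r - 1)"
    using ev(1) dvd_r_square dvd_trans by blast
  then have r: "odd r"
    by auto
  obtain H K where HK: "V = seq H K"
    using obtain_seq[OF V(1)] .
  show ?thesis
  proof (cases "\<exists>b b'. {#b, b'#} \<subseteq># K \<and> even (b - b')")
    case True
    then obtain b b' where b: "{#b, b'#} \<subseteq># K" "even (b - b')"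
      by blast
    have "{#flip b, flip b'#} \<subseteq># V"
      using seq_mono[OF _ b(1), of "{#}" H] HK by (simp add: seq_def)
    moreover have "block 2 ({#flip b, flip b'#}, b + r * b' + s)"
      using b(2) r ev is_product_two_flips by (simp add: block_def)
    ultimately show ?thesis
      by (intro exI conjI) auto
  next
    case noK: False
    then have K: "size K \<le> 2"
      using congruent_pair[of 2 K] by (metis leI of_nat_less_iff of_nat_numeral zero_less_numeral)
    show ?thesis
    proof (cases "\<exists>h\<in>#H. even h")
      case True
      then obtain h where h: "h \<in># H" "even h"
        by blast
      have "{#rot h#} \<subseteq># V"
        using h HK by (simp add: seq_def)
      then show ?thesis
        using block_single_rot[of 2 h] h by (intro exI conjI) auto
    next
      case odd: False
      show ?thesis
      proof (cases "size H \<le> 1")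
        case False
        then obtain H' where H': "H' \<subseteq># H" "size H' = 2"
          using obtain_submultiset_of_size[of 2 H] by auto
        obtain h h' where h: "H' = {#h, h'#}"
          using size_2_multisetE[OF H'(2)] .
        have "odd h" "odd h'"
          using odd H'(1) h by (auto dest: mset_subset_eqD)
        then have "block 2 (seq H' {#}, \<Sum>\<^sub># H')"
          using is_product_rots[of H'] by (simp add: h block_def)
        moreover have "seq H' {#} \<subseteq># V"
          using seq_mono[OF H'(1), of "{#}" K] HK by simp
        ultimately show ?thesis
          using H'(2) by (intro exI conjI) auto
      next
        case True
        \<comment> \<open>What remains is one odd rotation and two reflections of different parity:
          the three nontrivial classes of the Klein four-group, whose product is trivial.\<close>
        then have sz: "size H = 1" "size K = 2" "size V = 3"
          using K V(2) HK by auto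
        obtain h where h: "H = {#h#}"
          using sz(1) size_1_singleton_mset by blast
        obtain b b' where b: "K = {#b, b'#}"
          using size_2_multisetE[OF sz(2)] .
        have "is_product V (rot (b + r * b' + s + h))"
          using is_product_add[OF is_product_two_flips is_product_single[of "rot h"], of b b']
          by (simp add: HK h b seq_def rot_mult_rot add_mset_commute)
        moreover have "{#b, b'#} \<subseteq># K"
          by (simp add: b)
        then have "odd (b - b')"
          using noK by blast
        then have "even (b + r * b' + s + h)"
          using odd r ev(2) by (simp add: h)
        ultimately have "block 2 (V, b + r * b' + s + h)"
          using V(2) by (auto simp: block_def)
        then show ?thesis
          using sz(3) by blast
      qed
    qed
  qed
qed

text \<open>Since only the last block may need three terms,
  \<open>3 + 2 * (n / 2 - 1) = n + 1\<close> terms contain \<open>n / 2\<close> blocks modulo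
  \<open>2\<close>.\<close>

lemma product_one_free_size_bound_even:
  assumes ev: "even n" "even s" and V: "product_one_free G V"
  shows "int (size V) \<le> n"
proof (rule ccontr)
  assume large: "\<not> int (size V) \<le> n"
  obtain e where e: "n = 2 * e"
    using ev(1) by blast
  then have "0 < e"
    using n_pos by simp
  then obtain g where g: "e = int (Suc g)"
    by (rule pos_int_SucE)
  have "\<exists>Z. size Z = Suc g \<and> (\<forall>p\<in>#Z. block 2 p) \<and> \<Sum>\<^sub># (image_mset fst Z) \<subseteq># V"
  proof (rule obtain_blocks[where l = 3 and m = 2])
    show "\<exists>T u. T \<subseteq># V' \<and> block 2 (T, u)" if "set_mset V' \<subseteq> carrier G" "3 \<le> size V'" for V'
      using even_block[OF ev that] by blast
    show "\<exists>T u. T \<subseteq># V' \<and> block 2 (T, u) \<and> size T \<le> 2"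
      if "set_mset V' \<subseteq> carrier G" "3 + 2 \<le> size V'" for V'
    proof -
      have "3 \<le> size V'" "size V' \<noteq> 3"
        using that(2) by auto
      then show ?thesis
        using even_block[OF ev that(1)] by blast
    qed
    show "set_mset V \<subseteq> carrier G"
      using V unfolding product_one_free_def by blast
    show "3 + 2 * g \<le> size V"
      using large e g by linarith
  qed
  then show False
    using not_product_one_free_if_blocks[of _ 2 V] V e g by metis
qed

section \<open>Residues reached by subsequences\<close>

text \<open>The analogue of the set of subsequence sums, over all orderings whose product is a
  rotation. The empty subsequence contributes \<open>0\<close>.\<close>

definition reach :: "'a multiset \<Rightarrow> int set" where
  "reach V = {u mod N | u T. T \<subseteq># V \<and> is_product T (rot u)}"

lemma reach_subset: "reach V \<subseteq> {0..<N}"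
  using N_pos unfolding reach_def by auto

lemma zero_in_reach: "0 \<in> reach V"
proof -
  have "is_product {#} (rot 0)"
    by (simp add: is_product_empty)
  then show ?thesis
    unfolding reach_def by (intro CollectI exI[of _ 0] exI[of _ "{#}"]) auto
qed

lemma reach_mono: "V \<subseteq># W \<Longrightarrow> reach V \<subseteq> reach W"
  unfolding reach_def using subset_mset.order_trans by blast

text \<open>Appending all of \<open>W\<close> to a subsequence adds \<open>w\<close> to its
  exponent; \<open>d\<close> is a convenient representative of \<open>w\<close> modulo
  \<open>N\<close>.\<close>

lemma shift_reach:
  assumes "is_product W (rot w)" "N dvd w - d"
  shows "shift_mod N d (reach V) \<subseteq> reach (V + W)"
proof
  fix z assume "z \<in> shift_mod N d (reach V)"
  then obtain T u where T: "T \<subseteq># V" "is_product T (rot u)" "z = (u mod N + d) mod N"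
    unfolding shift_mod_def reach_def by auto
  have "is_product (T + W) (rot (u + w))"
    using is_product_add[OF T(2) assms(1)] by (simp add: rot_mult_rot)
  moreover have "z = (u + w) mod N"
    using assms(2) T(3) by (metis mod_add_left_eq mod_add_right_eq mod_eq_dvd_iff)
  moreover have "T + W \<subseteq># V + W"
    using T(1) by simp
  ultimately show "z \<in> reach (V + W)"
    unfolding reach_def by blast
qed

definition block_free :: "'a multiset \<Rightarrow> bool" where
  "block_free V \<longleftrightarrow> \<not> (\<exists>T u. T \<subseteq># V \<and> block N (T, u))"

lemma block_free_mono: "block_free W \<Longrightarrow> V \<subseteq># W \<Longrightarrow> block_free V"
  unfolding block_free_def using subset_mset.order_trans by blast

text \<open>A subsequence of residue \<open>- d\<close>, extended by \<open>W\<close>, would be a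
  block. This supplies the condition under which translates add new residues.\<close>

lemma zero_notin_shift_reach:
  assumes free: "block_free (V + W)" and W: "is_product W (rot w)" "N dvd w - d" "W \<noteq> {#}"
  shows "0 \<notin> shift_mod N d (reach V)"
proof
  assume "0 \<in> shift_mod N d (reach V)"
  then obtain T u where T: "T \<subseteq># V" "is_product T (rot u)" "N dvd u mod N + d"
    unfolding zero_in_shift_mod[OF reach_subset] by (auto simp: reach_def)
  have "is_product (T + W) (rot (u + w))"
    using is_product_add[OF T(2) W(1)] by (simp add: rot_mult_rot)
  moreover have "N dvd u + w"
  proof -
    have "u + w = (u mod N + d) + (w - d) + N * (u div N)"
      by (simp add: algebra_simps)
    then show ?thesis
      using T(3) W(2) by (metis dvd_add dvd_triv_left)
  qed
  moreover have "T + W \<subseteq># V + W"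
    using T(1) by simp
  ultimately show False
    using free W(3) unfolding block_free_def block_def
    by (metis (mono_tags, lifting) case_prodI empty_eq_union)
qed

text \<open>Each rotation enlarges the reachable set by one element and each pair of reflections by two,
  because its two products have opposite residues modulo the odd number \<open>N\<close>.\<close>

lemma card_reach:
  assumes "odd N"
  shows "even (size K) \<Longrightarrow> block_free (seq H K) \<Longrightarrow> 1 + size H + size K \<le> card (reach (seq H K))"
\<comment> \<open>Strong induction, because reflections are removed in pairs; the base case is an
  induction on the rotations.\<close>
proof (induction "size K" arbitrary: K rule: less_induct)
  case less
  have finite_reach: "finite (reach V)" for V
    using reach_subset finite_subset by blast
  show ?case
  proof (cases "K = {#}")
    case True
    have "block_free (seq H {#}) \<Longrightarrow> 1 + size H \<le> card (reach (seq H {#}))"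
    proof (induction H)
      case empty
      have "{0} \<subseteq> reach (seq {#} {#})"
        using zero_in_reach by simp
      then have "card {0::int} \<le> card (reach (seq {#} {#}))"
        using finite_reach by (rule card_mono[rotated])
      then show ?case
        by simp
    next
      case (add h H)
      let ?V = "seq H {#}"
      have eq: "seq (add_mset h H) {#} = ?V + {#rot h#}"
        by (simp add: seq_def)
      have h: "is_product {#rot h#} (rot h)" "N dvd h - h"
        by (simp_all add: is_product_single)
      have "card (reach ?V) + 1 \<le> card (reach ?V \<union> shift_mod N h (reach ?V))"
        using zero_notin_shift_reach[OF _ h] add.prems unfolding eq
        by (intro card_Un_shift_mod N_pos reach_subset zero_in_reach) auto
      also have "\<dots> \<le> card (reach (seq (add_mset h H) {#}))"
        unfolding eq using shift_reach[OF h, of ?V] reach_mono[of ?V "?V + {#rot h#}"] finite_reach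
        by (intro card_mono) auto
      finally show ?case
        using add.IH block_free_mono[OF add.prems] unfolding eq by simp
    qed
    then show ?thesis
      using True less.prems by simp
  next
    case False
    then obtain b K1 where K1: "K = add_mset b K1"
      by (meson multiset_cases)
    then have "K1 \<noteq> {#}"
      using less.prems(1) by auto
    then obtain b' K' where K': "K = add_mset b (add_mset b' K')"
      using K1 by (cases K1) auto
    let ?V = "seq H K'" and ?W = "{#flip b, flip b'#}" and ?d = "b - b'"
    have eq: "seq H K = ?V + ?W"
      by (simp add: seq_def K')
    \<comment> \<open>Since \<open>r = -1\<close> and \<open>s = 0\<close> modulo \<open>N\<close>,
      the two orders of the pair yield the residues of \<open>?d\<close> and
      \<open>- ?d\<close>.\<close>
    have pos: "is_product ?W (rot (b + r * b' + s))" "N dvd b + r * b' + s - ?d"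
    proof -
      have "b + r * b' + s - ?d = (r * b' + b') + s"
        by simp
      then show "N dvd b + r * b' + s - ?d"
        using N_dvd_r_minus_minus_1 N_dvd_s by (metis dvd_add)
    qed (rule is_product_two_flips)
    have neg: "is_product ?W (rot (b' + r * b + s))" "N dvd b' + r * b + s - (- ?d)"
    proof -
      have "b' + r * b + s - (- ?d) = (r * b + b) + s"
        by simp
      then show "N dvd b' + r * b + s - (- ?d)"
        using N_dvd_r_minus_minus_1 N_dvd_s by (metis dvd_add)
      show "is_product ?W (rot (b' + r * b + s))"
        using is_product_two_flips[of b' b] by (simp add: add_mset_commute)
    qed
    have free: "block_free (?V + ?W)"
      using less.prems(2) unfolding eq .
    have "1 + size H + size K' \<le> card (reach ?V)"
    proof (rule less.hyps)
      show "size K' < size K" "even (size K')"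
        using less.prems(1) K' by auto
      show "block_free ?V"
        by (rule block_free_mono[OF free]) simp
    qed
    moreover have "card (reach ?V) + 2 \<le>
        card (reach ?V \<union> shift_mod N ?d (reach ?V) \<union> shift_mod N (- ?d) (reach ?V))"
      using zero_notin_shift_reach[OF free pos] zero_notin_shift_reach[OF free neg]
      by (intro card_Un_shift_mod_both N_pos reach_subset zero_in_reach assms) auto
    moreover have "\<dots> \<le> card (reach (seq H K))"
      unfolding eq using shift_reach[OF pos, of ?V] shift_reach[OF neg, of ?V]
        reach_mono[of ?V "?V + ?W"] finite_reach
      by (intro card_mono) auto
    ultimately show ?thesis
      by (simp add: K')
  qed
qed

text \<open>Without a block, \<open>card_reach\<close> would yield more than \<open>N\<close>
  residues modulo \<open>N\<close>.\<close>

lemma obtain_block_even_flips: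
  assumes "odd N" "even (size K)" "N \<le> int (size H + size K)"
  shows "\<exists>T u. T \<subseteq># seq H K \<and> block N (T, u)"
proof (rule ccontr)
  assume "\<nexists>T u. T \<subseteq># seq H K \<and> block N (T, u)"
  then have "1 + size H + size K \<le> card (reach (seq H K))"
    using assms by (intro card_reach) (auto simp: block_free_def)
  also have "\<dots> \<le> card {0..<N}"
    by (intro card_mono reach_subset) simp
  finally show False
    using assms(3) N_pos by simp
qed

text \<open>From \<open>N + 1\<close> terms one is dropped so that the number of reflections becomes
  or stays even: a reflection if it is odd, otherwise a rotation. If it is even and no rotation
  exists, two of the \<open>N + 1\<close> reflections are congruent.\<close>

lemma odd_block:
  assumes N: "odd N" "2 \<le> N" and V: "set_mset V \<subseteq> carrier G" "N < int (size V)"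
  shows "\<exists>T u. T \<subseteq># V \<and> block N (T, u) \<and> int (size T) \<le> N"
proof -
  obtain V' where V': "V' \<subseteq># V" "size V' = nat (N + 1)"
  proof (rule obtain_submultiset_of_size)
    show "nat (N + 1) \<le> size V"
      using V(2) by linarith
  qed
  have size: "int (size V') = N + 1"
    using V'(2) N(2) by simp
  have "set_mset V' \<subseteq> carrier G"
    using V(1) V'(1) set_mset_mono by blast
  then obtain H K where HK: "V' = seq H K"
    using obtain_seq by blast
  have sub: ?thesis
    if HK': "H' \<subseteq># H" "K' \<subseteq># K" "even (size K')" "int (size H' + size K') = N" for H' K'
  proof -
    obtain T u where T: "T \<subseteq># seq H' K'" "block N (T, u)"
      using obtain_block_even_flips[OF N(1) HK'(3), of H'] HK'(4) by fastforce
    moreover have "T \<subseteq># V"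
      using T(1) seq_mono[OF HK'(1,2)] V'(1) HK by (metis subset_mset.order_trans)
    moreover have "int (size T) \<le> N"
      using size_mset_mono[OF T(1)] HK'(4) by simp
    ultimately show ?thesis
      by blast
  qed
  show ?thesis
  proof (cases "even (size K)")
    case False
    then obtain b K' where "K = add_mset b K'"
      by (metis multiset_cases even_zero size_empty)
    then show ?thesis
      using sub[of H K'] size False HK by auto
  next
    case True
    show ?thesis
    proof (cases "H = {#}")
      case False
      then obtain h H' where "H = add_mset h H'"
        by (meson multiset_cases)
      then show ?thesis
        using sub[of H' K] size True HK by auto
    next
      case H: True
      have "N < int (size K)"
        using size HK H by simp
      then obtain b b' where b: "{#b, b'#} \<subseteq># K" "N dvd b - b'"
        using congruent_pair[OF N_pos] by blast
      have "b + r * b' + s = (b - b') + (r * b' + b') + s"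
        by simp
      then have "N dvd b + r * b' + s"
        using b(2) N_dvd_s N_dvd_r_minus_minus_1 by (metis dvd_add)
      then have "block N ({#flip b, flip b'#}, b + r * b' + s)"
        using is_product_two_flips by (simp add: block_def)
      moreover have "{#flip b, flip b'#} \<subseteq># V'"
        using seq_mono[OF _ b(1), of "{#}" H] HK by (simp add: seq_def)
      ultimately show ?thesis
        using V'(1) N(2) by (intro exI conjI) (auto intro: subset_mset.order_trans)
    qed
  qed
qed

text \<open>By \<open>odd_block\<close>, \<open>N + 1 + N * (n / N - 1) = n + 1\<close> terms
  contain \<open>n / N\<close> blocks.\<close>

lemma product_one_free_size_bound_odd:
  assumes N: "odd N" "2 \<le> N" and V: "product_one_free G V"
  shows "int (size V) \<le> n"
proof (rule ccontr)
  assume large: "\<not> int (size V) \<le> n"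
  obtain e where e: "n = N * e"
    using N_dvd_n by blast
  then have "0 < e"
    using n_pos N_pos by (metis zero_less_mult_pos)
  then obtain g where g: "e = int (Suc g)"
    by (rule pos_int_SucE)
  obtain m where m: "N = int m"
    using N_pos by (metis pos_int_cases)
  have block: "\<exists>T u. T \<subseteq># V' \<and> block N (T, u) \<and> size T \<le> m"
    if "set_mset V' \<subseteq> carrier G" "m + 1 \<le> size V'" for V'
    using odd_block[OF N that(1)] that(2) m by auto
  have "\<exists>Z. size Z = Suc g \<and> (\<forall>p\<in>#Z. block N p) \<and> \<Sum>\<^sub># (image_mset fst Z) \<subseteq># V"
  proof (rule obtain_blocks[where l = "m + 1" and m = m])
    show "\<exists>T u. T \<subseteq># V' \<and> block N (T, u)" if "set_mset V' \<subseteq> carrier G" "m + 1 \<le> size V'" for V'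
      using block[OF that] by blast
    show "\<exists>T u. T \<subseteq># V' \<and> block N (T, u) \<and> size T \<le> m"
      if "set_mset V' \<subseteq> carrier G" "m + 1 + m \<le> size V'" for V'
      using block[OF that(1)] that(2) by auto
    show "set_mset V \<subseteq> carrier G"
      using V unfolding product_one_free_def by blast
    have "n = int (m * g + m)"
      using e g m by (simp add: algebra_simps)
    then show "m + 1 + m * g \<le> size V"
      using large by linarith
  qed
  then show False
    using not_product_one_free_if_blocks[of _ N V] V e g by metis
qed

text \<open>For \<open>N = 1\<close> the square of \<open>flip i\<close> is
  \<open>rot (2 * i + s)\<close>. If \<open>s\<close> or \<open>n\<close> is odd, some
  \<open>i\<close> makes this equal to \<open>a\<close>, and then \<open>flip i\<close> generates
  \<open>G\<close>.\<close>

lemma cyclic_if_N_eq_1: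
  assumes N: "N = 1" and "\<not> (even n \<and> even s)"
  shows "cyclic_group G"
proof -
  have "\<exists>i. n dvd 2 * i + s - 1"
  proof (cases "odd s")
    case True
    then obtain k where "s = 2 * k + 1"
      using oddE by blast
    then have "2 * (- k) + s - 1 = 0"
      by simp
    then show ?thesis
      by (metis dvd_0_right)
  next
    case False
    then obtain k l where "s = 2 * k" "n = 2 * l + 1"
      using assms(2) by (metis evenE oddE)
    then have "2 * (l - k + 1) + s - 1 = n"
      by simp
    then show ?thesis
      by (metis dvd_refl)
  qed
  then obtain i where i: "n dvd 2 * i + s - 1"
    by blast
  have "i + r * i + s - 1 = (2 * i + s - 1) + (r - 1) * i"
    by (simp add: algebra_simps)
  moreover have "n dvd (r - 1) * i"
    unfolding dvd_r_minus_1_mult_iff N by simp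
  ultimately have "n dvd i + r * i + s - 1"
    using i by (metis dvd_add)
  then have sq: "flip i \<otimes> flip i = rot 1"
    by (simp add: flip_mult_flip rot_eq_iff)
  have even_pow: "flip i [^] (2 * j) = rot j" for j :: int
  proof -
    have "flip i [^] (2 :: int) = flip i \<otimes> flip i"
      using int_pow_mult[of "flip i" 1 1] by simp
    then have "flip i [^] (2 :: int) = a"
      unfolding sq by (simp add: rot_def)
    then show ?thesis
      using int_pow_pow[of "flip i" 2 j] by (simp add: rot_def)
  qed
  have odd_pow: "flip i [^] (2 * j + 1) = flip (j + i)" for j :: int
    using int_pow_mult[of "flip i" "2 * j" 1] by (simp add: even_pow rot_mult_flip)
  have "g \<in> range (\<lambda>z :: int. flip i [^] z)" if g: "g \<in> carrier G" for g
  proof -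
    consider j where "g = rot j" | j where "g = flip j"
      using g carrier_eq by auto
    then show ?thesis
    proof cases
      case 1
      then show ?thesis
        using even_pow by (metis rangeI)
    next
      case 2
      then show ?thesis
        using odd_pow[of "j - i"] by (metis rangeI diff_add_cancel)
    qed
  qed
  then have "carrier G = range (\<lambda>z :: int. flip i [^] z)"
    by auto
  then show ?thesis
    unfolding cyclic_group by (metis flip_closed)
qed

text \<open>As \<open>N\<close> divides both \<open>n\<close> and \<open>s\<close>, it is odd unless
  both are even, and it is not \<open>1\<close> because \<open>G\<close> is not cyclic.\<close>

lemma product_one_free_size_bound:
  assumes "\<not> cyclic_group G" "product_one_free G V"
  shows "int (size V) \<le> n"
proof (cases "even n \<and> even s")
  case True
  then show ?thesis
    using product_one_free_size_bound_even assms(2) by blast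
next
  case False
  have "odd N"
    using False N_dvd_n N_dvd_s dvd_trans by blast
  moreover have "N \<noteq> 1"
    using cyclic_if_N_eq_1 False assms(1) by blast
  ultimately show ?thesis
    using product_one_free_size_bound_odd assms(2) N_pos by simp
qed

section \<open>Extremal sequences\<close>

text \<open>Exponents cannot be compared directly, but the rotations and reflections of a sequence
  can be filtered out, as no element is both.\<close>

lemma seq_subset_seqD:
  assumes "seq H' K' \<subseteq># seq H K"
  shows "image_mset rot H' \<subseteq># image_mset rot H" "image_mset flip K' \<subseteq># image_mset flip K"
proof -
  have rots: "filter_mset (\<lambda>g. g \<in> range rot) (seq H K) = image_mset rot H" for H K
    unfolding seq_def by (simp add: filter_mset_image_mset) (metis filter_mset_False imageE rot_neq_flip)
  have flips: "filter_mset (\<lambda>g. g \<in> range flip) (seq H K) = image_mset flip K" for H K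
    unfolding seq_def by (simp add: filter_mset_image_mset) (metis filter_mset_False imageE rot_neq_flip)
  show "image_mset rot H' \<subseteq># image_mset rot H" "image_mset flip K' \<subseteq># image_mset flip K"
    using multiset_filter_mono[OF assms, of "\<lambda>g. g \<in> range rot"]
      multiset_filter_mono[OF assms, of "\<lambda>g. g \<in> range flip"]
    unfolding rots flips by blast+
qed

lemma seq_replicate_dvd:
  assumes "seq H K \<subseteq># seq (replicate_mset m 1) K0"
  shows "size H \<le> m" "p \<in># H \<Longrightarrow> n dvd p - 1"
proof -
  have sub: "image_mset rot H \<subseteq># replicate_mset m (rot 1)"
    using seq_subset_seqD(1)[OF assms] by simp
  show "size H \<le> m"
    using size_mset_mono[OF sub] by simp
  show "n dvd p - 1" if "p \<in># H"
  proof -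
    have "rot p \<in># replicate_mset m (rot 1)"
      by (rule mset_subset_eqD[OF sub]) (use that in simp)
    then show ?thesis
      by (simp add: rot_eq_iff split: if_splits)
  qed
qed

lemma product_one_rots_size:
  assumes T: "product_one G T" "T \<subseteq># seq (replicate_mset m 1) K" "T = seq H {#}"
  shows "n dvd int (size T)"
proof -
  have "is_product T (rot 0)"
    using T(1) by (simp add: product_one_iff_is_product)
  from is_product_rotD[OF this]
  obtain P Q B B' where conf: "T = seq (P + Q) (B + B')" "size B = size B'"
    "n dvd weight P Q B B' - 0" "B = {#} \<Longrightarrow> Q = {#}"
    by metis
  have "B + B' = {#}"
    using T(3) conf(1) flip_in_seq_iff by metis
  then have P: "T = seq P {#}" "n dvd \<Sum>\<^sub># P"
    using conf by (auto simp: weight_def)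
  have "n dvd \<Sum>\<^sub># P - int (size P) * 1"
    using T(2) P(1) seq_replicate_dvd(2) by (intro dvd_sum_minus_size_mult) metis
  moreover have "int (size P) = \<Sum>\<^sub># P - (\<Sum>\<^sub># P - int (size P) * 1)"
    by simp
  ultimately have "n dvd int (size P)"
    using P(2) by (metis dvd_diff)
  then show ?thesis
    by (simp add: P(1))
qed

text \<open>Reflections alternate between \<open>B\<close> and \<open>B'\<close>, which have equal
  size when the product is a rotation.\<close>

lemma product_one_even_flips:
  assumes "product_one G (seq H K)"
  shows "even (size K)"
proof -
  have "is_product (seq H K) (rot 0)"
    using assms by (simp add: product_one_iff_is_product)
  from is_product_rotD[OF this]
  obtain P Q B B' where conf: "seq H K = seq (P + Q) (B + B')" "size B = size B'"
    by metis
  have "image_mset flip K \<subseteq># image_mset flip (B + B')" "image_mset flip (B + B') \<subseteq># image_mset flip K"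
    using seq_subset_seqD(2) conf(1) by (metis subset_mset.order_refl)+
  then have "size K = size (B + B')"
    by (metis size_image_mset subset_mset.antisym)
  then show ?thesis
    using conf(2) by simp
qed

text \<open>Parity excludes the single reflection, and between \<open>1\<close> and
  \<open>n - 1\<close> copies of \<open>rot 1\<close> never multiply to the identity.\<close>

lemma product_one_free_example: "product_one_free G (seq (replicate_mset (nat n - 1) 1) {#0#})"
  unfolding product_one_free_def
proof (intro conjI notI seq_closed; elim exE conjE)
  fix T assume T: "T \<subseteq># seq (replicate_mset (nat n - 1) 1) {#0#}" "T \<noteq> {#}" "product_one G T"
  obtain H K where HK: "T = seq H K"
    using T(3) obtain_seq unfolding product_one_def by metis
  have "size K \<le> 1"
    using size_mset_mono[OF seq_subset_seqD(2)[OF T(1)[unfolded HK]]] by simp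
  then have "K = {#}"
    using product_one_even_flips T(3) HK
    by (metis One_nat_def dvd_1_left even_Suc le_Suc_eq le_zero_eq nonempty_has_size odd_one size_eq_0_iff_empty)
  then have "n dvd int (size T)"
    using product_one_rots_size[OF T(3,1)] HK by blast
  moreover have "size T \<le> nat n - 1"
    using seq_replicate_dvd(1)[OF T(1)[unfolded HK]] HK \<open>K = {#}\<close> by simp
  moreover have "0 < size T"
    using T(2) by (simp add: nonempty_has_size)
  ultimately show False
    using zdvd_imp_le[of n "int (size T)"] by linarith
qed

text \<open>The exponent \<open>e\<close> is chosen such that the product is \<open>\<one>\<close> exactly when the number of rotations
  between the two reflections is \<open>-1\<close> modulo \<open>N\<close>.\<close>

lemma minimal_product_one_example:
  obtains S where "minimal_product_one G S" "int (size S) = n + N"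
proof -
  \<comment> \<open>With the two reflections, \<open>l\<close> copies of \<open>rot 1\<close> make a
    sequence of length \<open>n + N\<close>.\<close>
  define l where "l = nat (n + N - 2)"
  define e where "e = - (n + N - 2) - s - (r - 1) * (N - 1)"
  define S where "S = seq (replicate_mset l 1) {#0, e#}"
  have l: "int l = n + N - 2"
    unfolding l_def using n_pos N_pos by simp
  have dvd_mult_N: "n dvd (r - 1) * N"
    unfolding dvd_r_minus_1_mult_iff by simp
  have N_le: "N \<le> n"
    using N_dvd_n n_pos by (rule zdvd_imp_le)
  \<comment> \<open>Hence \<open>r * e = e\<close> modulo \<open>n\<close>, and it does not matter
    which of the two reflections comes first.\<close>
  have "N dvd e"
  proof -
    have "e = - n - s - (r + 1) * (N - 1) + N"
      by (simp add: e_def algebra_simps)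
    then show ?thesis
      using N_dvd_n N_dvd_s N_dvd_r_plus_1 by (metis dvd_add dvd_diff dvd_minus_iff dvd_mult2 dvd_refl)
  qed
  then have re: "n dvd (r - 1) * e"
    unfolding dvd_r_minus_1_mult_iff .
  have "product_one G S"
  proof -
    \<comment> \<open>With \<open>N - 1\<close> rotations between the reflections, the weight is
      exactly \<open>0\<close>.\<close>
    let ?P = "replicate_mset (l - nat (N - 1)) (1::int)" and ?Q = "replicate_mset (nat (N - 1)) (1::int)"
    have le: "nat (N - 1) \<le> l"
      using l n_pos N_pos by linarith
    have "?P + ?Q = replicate_mset l 1"
      using le by (simp add: multiset_eq_iff)
    moreover have "n dvd weight ?P ?Q {#e#} {#0#} - 0"
      using le l N_pos by (simp add: weight_def e_def of_nat_diff algebra_simps)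
    ultimately have "is_product S (rot 0)"
      by (intro is_product_congI[of "{#e#}" "{#0#}" ?Q ?P]) (auto simp: S_def add_mset_commute)
    then show ?thesis
      by (simp add: product_one_iff_is_product)
  qed
  \<comment> \<open>A part \<open>T\<close> without reflections has at least \<open>n\<close> terms,
    leaving at most \<open>N - 2\<close> rotations for \<open>U\<close>. But product one of
    \<open>U\<close> forces the number of rotations in \<open>Q\<close> to be \<open>-1\<close>
    modulo \<open>N\<close>.\<close>
  moreover have no_split: False
    if TU: "S = T + U" "product_one G T" "product_one G U" "T \<noteq> {#}" "T = seq H {#}" for T U H
  proof -
    have "n dvd int (size T)"
      using TU product_one_rots_size[of T l "{#0, e#}" H] by (simp add: S_def)
    moreover have "0 < size T"
      using TU(4) by (simp add: nonempty_has_size)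
    ultimately have sizeT: "n \<le> int (size T)"
      using zdvd_imp_le by force
    have "is_product U (rot 0)"
      using TU(3) by (simp add: product_one_iff_is_product)
    from is_product_rotD[OF this]
    obtain P Q B B' where conf: "U = seq (P + Q) (B + B')" "size B = size B'"
      "n dvd weight P Q B B' - 0"
      by metis
    have S: "S = seq (H + (P + Q)) (B + B')"
      using TU(1,5) conf(1) seq_add[of H "P + Q" "{#}"] by simp
    have "image_mset flip (B + B') \<subseteq># {#flip 0, flip e#}" "{#flip 0, flip e#} \<subseteq># image_mset flip (B + B')"
      using seq_subset_seqD(2)[of "H + (P + Q)" "B + B'" "replicate_mset l 1" "{#0, e#}"]
        seq_subset_seqD(2)[of "replicate_mset l 1" "{#0, e#}" "H + (P + Q)" "B + B'"] S
      unfolding S_def by auto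
    then have flips: "image_mset flip (B + B') = {#flip 0, flip e#}"
      by (rule subset_mset.antisym)
    then have "size (image_mset flip (B + B')) = 2"
      by simp
    then have "size B = 1" "size B' = 1"
      using conf(2) by auto
    then obtain b b' where b: "B = {#b#}" "B' = {#b'#}"
      by (metis size_1_singleton_mset)
    have bb: "n dvd b + r * b' - e"
    proof -
      have "{#flip b, flip b'#} = {#flip 0, flip e#}"
        using flips by (simp add: b add_mset_commute)
      then have "flip b = flip 0 \<and> flip b' = flip e \<or> flip b = flip e \<and> flip b' = flip 0"
        by (auto simp: add_eq_conv_ex)
      then have "n dvd b \<and> n dvd b' - e \<or> n dvd b - e \<and> n dvd b'"
        by (simp add: flip_eq_iff)
      moreover have "b + r * b' - e = b + r * (b' - e) + (r - 1) * e" "b + r * b' - e = (b - e) + r * b'"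
        by (simp_all add: algebra_simps)
      ultimately show ?thesis
        using re by (metis dvd_add dvd_mult)
    qed
    have PQ: "n dvd \<Sum>\<^sub># P - int (size P) * 1" "n dvd \<Sum>\<^sub># Q - int (size Q) * 1"
      using seq_replicate_dvd(2)[of "H + (P + Q)" "B + B'" l "{#0, e#}"] S S_def
      by (intro dvd_sum_minus_size_mult; simp)+
    have "size S = l + 2"
      by (simp add: S_def)
    then have "size T + size P + size Q = l"
      using TU(1) conf(1) by (simp add: b)
    moreover have "n dvd int (size T)"
      by fact
    ultimately have sz: "size P + size Q \<le> nat (N - 2)" "n dvd int l - int (size P) - int (size Q)"
      using sizeT l by (auto simp: algebra_simps)
    have "(r - 1) * (int (size Q) - (N - 1)) =
        (weight P Q B B' - 0) - (\<Sum>\<^sub># P - int (size P) * 1) - r * (\<Sum>\<^sub># Q - int (size Q) * 1)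
        - (b + r * b' - e) + (int l - int (size P) - int (size Q))"
      unfolding l by (simp add: weight_def b e_def algebra_simps)
    also have "n dvd \<dots>"
      using conf(3) PQ bb sz(2) by (simp only: dvd_add dvd_diff dvd_mult)
    finally have "N dvd int (size Q) - (N - 1)"
      unfolding dvd_r_minus_1_mult_iff .
    then have "N dvd (N - 1) - int (size Q)"
      by (metis dvd_minus_iff minus_diff_eq)
    moreover have "0 < N - 1 - int (size Q)"
      using sz(1) \<open>size T + size P + size Q = l\<close> sizeT l N_pos by linarith
    ultimately show False
      using zdvd_imp_le[of N "N - 1 - int (size Q)"] by simp
  qed
  \<comment> \<open>By parity, both reflections lie in the same part.\<close>
  have "\<not> (\<exists>T U. S = T + U \<and> T \<noteq> {#} \<and> U \<noteq> {#} \<and> product_one G T \<and> product_one G U)"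
  proof (intro notI; elim exE conjE)
    fix T U assume TU: "S = T + U" "T \<noteq> {#}" "U \<noteq> {#}" "product_one G T" "product_one G U"
    obtain H K H' K' where seqs: "T = seq H K" "U = seq H' K'"
      using TU(4,5) obtain_seq unfolding product_one_def by metis
    have "seq (replicate_mset l 1) {#0, e#} = seq (H + H') (K + K')"
      using TU(1) seqs S_def by (simp add: seq_add)
    then have "image_mset flip (K + K') \<subseteq># image_mset flip {#0, e#}"
      using seq_subset_seqD(2) by (metis subset_mset.order_refl)
    then have "size (image_mset flip (K + K')) \<le> size (image_mset flip {#0, e#})"
      by (rule size_mset_mono)
    then have "size K + size K' \<le> 2"
      by simp
    moreover have "even (size K)" "even (size K')"
      using product_one_even_flips TU(4,5) seqs by auto
    ultimately have "size K = 0 \<or> size K' = 0"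
      by presburger
    then show False
      using no_split[of T U H] no_split[of U T H'] TU seqs by (auto simp: add.commute)
  qed
  moreover have "S \<noteq> {#}"
    by (simp add: S_def)
  ultimately have "minimal_product_one G S"
    unfolding minimal_product_one_def by blast
  moreover have "int (size S) = n + N"
    by (simp add: S_def l)
  ultimately show thesis
    using that by blast
qed

section \<open>Orders of the group and its commutator subgroup\<close>

lemma order_eq: "order G = 2 * nat n"
proof -
  have rots: "bij_betw rot {0..<n} (range rot)"
  proof (rule bij_betw_imageI)
    show "inj_on rot {0..<n}"
    proof (rule inj_onI)
      fix i j assume "i \<in> {0..<n}" "j \<in> {0..<n}" "rot i = rot j"
      then show "i = j"
        by (metis rot_eq_iff mod_eq_dvd_iff atLeastLessThan_iff mod_pos_pos_trivial)
    qed
    have "rot i \<in> rot ` {0..<n}" for i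
    proof
      show "rot i = rot (i mod n)"
        by (simp add: rot_eq_iff minus_mod_eq_mult_div)
    qed (use n_pos in simp)
    then show "rot ` {0..<n} = range rot"
      by blast
  qed
  have flips: "bij_betw (\<lambda>g. g \<otimes> x) (range rot) (range flip)"
  proof (rule bij_betw_imageI)
    show "inj_on (\<lambda>g. g \<otimes> x) (range rot)"
      by (rule inj_onI) auto
    show "(\<lambda>g. g \<otimes> x) ` range rot = range flip"
      unfolding image_image by (simp add: rot_def flip_def)
  qed
  have rots': "card (range rot) = nat n" "finite (range rot)"
    using bij_betw_same_card[OF rots] bij_betw_finite[OF rots] by auto
  then have "card (range flip) = nat n" "finite (range flip)"
    using bij_betw_same_card[OF flips] bij_betw_finite[OF flips] by auto
  moreover have "range rot \<inter> range flip = {}"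
    using rot_neq_flip by auto
  ultimately show ?thesis
    unfolding order_def carrier_eq using rots' by (subst card_Un_disjoint) auto
qed

lemma finite_carrier: "finite (carrier G)"
  using order_eq n_pos unfolding order_def by (intro card_ge_0_finite) simp

text \<open>Comparing \<open>g \<otimes> h\<close> with \<open>h \<otimes> g\<close> avoids
  computing inverses of reflections.\<close>

lemma commutator_rot:
  assumes "g \<in> carrier G" "h \<in> carrier G"
  obtains z where "g \<otimes> h \<otimes> inv g \<otimes> inv h = rot ((r - 1) * z)"
proof -
  have "\<exists>z. g \<otimes> h = rot ((r - 1) * z) \<otimes> (h \<otimes> g)"
  proof -
    consider i j where "g = rot i" "h = rot j" | i j where "g = rot i" "h = flip j"
      | i j where "g = flip i" "h = rot j" | i j where "g = flip i" "h = flip j"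
      using assms carrier_eq by auto
    then show ?thesis
    proof cases
      case 1
      then show ?thesis
        by (intro exI[of _ 0]) (simp add: rot_mult_rot add.commute)
    next
      case (2 i j)
      then show ?thesis
        by (intro exI[of _ "- i"]) (simp add: rot_mult_flip flip_mult_rot algebra_simps)
    next
      case (3 i j)
      then show ?thesis
        by (intro exI[of _ j]) (simp add: rot_mult_flip flip_mult_rot algebra_simps)
    next
      case (4 i j)
      then show ?thesis
        by (intro exI[of _ "j - i"]) (simp add: flip_mult_flip rot_mult_rot algebra_simps)
    qed
  qed
  then obtain z where "g \<otimes> h = rot ((r - 1) * z) \<otimes> (h \<otimes> g)"
    by blast
  then have "g \<otimes> h \<otimes> inv (h \<otimes> g) = rot ((r - 1) * z)"
    using assms by (simp add: m_assoc)
  then show thesis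
    using that assms by (simp add: inv_mult_group m_assoc)
qed

text \<open>The right side is a subgroup containing all commutators, and each of its elements is
  itself a commutator, of \<open>flip 0\<close> and \<open>rot z\<close>.\<close>

lemma derived_eq: "derived G (carrier G) = range (\<lambda>z. rot ((r - 1) * z))"
  unfolding derived_def
proof (rule generateI[symmetric])
  show "subgroup (range (\<lambda>z. rot ((r - 1) * z))) G"
  proof (rule subgroupI)
    show "inv g \<in> range (\<lambda>z. rot ((r - 1) * z))" if "g \<in> range (\<lambda>z. rot ((r - 1) * z))" for g
    proof -
      from that obtain z where g: "g = rot ((r - 1) * z)"
        by blast
      have "inv g = rot ((r - 1) * (- z))"
        unfolding g by (rule inv_equality) (simp_all add: rot_mult_rot flip: distrib_left)
      then show ?thesis
        by blast
    qed
    show "g \<otimes> h \<in> range (\<lambda>z. rot ((r - 1) * z))"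
      if "g \<in> range (\<lambda>z. rot ((r - 1) * z))" "h \<in> range (\<lambda>z. rot ((r - 1) * z))" for g h
      using that by (auto simp: rot_mult_rot simp flip: distrib_left)
  qed auto
  show "derived_set G (carrier G) \<subseteq> range (\<lambda>z. rot ((r - 1) * z))"
  proof
    fix c assume "c \<in> derived_set G (carrier G)"
    then obtain g h where gh: "g \<in> carrier G" "h \<in> carrier G" "c = g \<otimes> h \<otimes> inv g \<otimes> inv h"
      by blast
    obtain z where "c = rot ((r - 1) * z)"
      using commutator_rot[OF gh(1,2)] gh(3) by metis
    then show "c \<in> range (\<lambda>z. rot ((r - 1) * z))"
      by blast
  qed
  show "range (\<lambda>z. rot ((r - 1) * z)) \<subseteq> K" if "derived_set G (carrier G) \<subseteq> K" for K
  proof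
    fix g assume "g \<in> range (\<lambda>z. rot ((r - 1) * z))"
    then obtain z where g: "g = rot ((r - 1) * z)"
      by (rule rangeE)
    have "flip 0 \<otimes> rot z = g \<otimes> (rot z \<otimes> flip 0)"
      by (simp add: g flip_mult_rot rot_mult_flip algebra_simps)
    then have "g = flip 0 \<otimes> rot z \<otimes> inv (rot z \<otimes> flip 0)"
      by (simp add: g m_assoc)
    then have "g = flip 0 \<otimes> rot z \<otimes> inv flip 0 \<otimes> inv rot z"
      by (simp add: inv_mult_group m_assoc)
    then have "g \<in> derived_set G (carrier G)"
      by (intro UN_I[of "flip 0"] UN_I[of "rot z"]) auto
    then show "g \<in> K"
      using that by blast
  qed
qed

lemma card_derived: "int (card (derived G (carrier G))) = N"
proof -
  have "bij_betw (\<lambda>z. rot ((r - 1) * z)) {0..<N} (range (\<lambda>z. rot ((r - 1) * z)))"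
  proof (rule bij_betw_imageI)
    have iff: "rot ((r - 1) * i) = rot ((r - 1) * j) \<longleftrightarrow> i mod N = j mod N" for i j
      unfolding rot_eq_iff by (simp add: dvd_r_minus_1_mult_iff mod_eq_dvd_iff flip: right_diff_distrib)
    show "inj_on (\<lambda>z. rot ((r - 1) * z)) {0..<N}"
      by (rule inj_onI) (simp add: iff)
    have "rot ((r - 1) * i) \<in> (\<lambda>z. rot ((r - 1) * z)) ` {0..<N}" for i
    proof
      show "rot ((r - 1) * i) = rot ((r - 1) * (i mod N))"
        unfolding iff by simp
    qed (use N_pos in simp)
    then show "(\<lambda>z. rot ((r - 1) * z)) ` {0..<N} = range (\<lambda>z. rot ((r - 1) * z))"
      by blast
  qed
  then show ?thesis
    unfolding derived_eq using bij_betw_same_card N_pos by fastforce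
qed

lemma comm_group_if_N_eq_1:
  assumes "N = 1"
  shows "comm_group G"
proof (rule group_comm_groupI)
  fix g h assume gh: "g \<in> carrier G" "h \<in> carrier G"
  obtain z where z: "g \<otimes> h \<otimes> inv g \<otimes> inv h = rot ((r - 1) * z)"
    using commutator_rot[OF gh] .
  have "rot ((r - 1) * z) = \<one>"
    unfolding rot_eq_one_iff dvd_r_minus_1_mult_iff assms by simp
  then have "g \<otimes> h \<otimes> inv (h \<otimes> g) = \<one>"
    using z gh by (simp add: inv_mult_group m_assoc)
  then show "g \<otimes> h = h \<otimes> g"
    using gh by (metis inv_equality inv_inv m_closed inv_closed)
qed

section \<open>Values of the Davenport constants\<close>

lemma small_davenport_eq:
  assumes "\<not> cyclic_group G"
  shows "int (small_davenport G) = n"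
proof -
  have "Max {size S | S. product_one_free G S} = nat n"
  proof (rule Max_eqI)
    show "finite {size S | S. product_one_free G S}"
      by (rule finite_product_one_free_sizes[OF finite_carrier])
    show "m \<le> nat n" if "m \<in> {size S | S. product_one_free G S}" for m
      using that product_one_free_size_bound[OF assms] by fastforce
    show "nat n \<in> {size S | S. product_one_free G S}"
      using product_one_free_example n_pos
      by (intro CollectI exI[of _ "seq (replicate_mset (nat n - 1) 1) {#0#}"]) simp
  qed
  then show ?thesis
    unfolding small_davenport_def using n_pos by simp
qed

text \<open>The splitting argument requires \<open>2 <= N\<close>. For \<open>N = 1\<close> the
  group is abelian, and a minimal sequence without one term is product-one free, of length at most
  \<open>n\<close>.\<close>

lemma large_davenport_eq:
  assumes "\<not> cyclic_group G"
  shows "int (large_davenport G) = n + N"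
proof -
  have le: "int (size S) \<le> n + N" if S: "minimal_product_one G S" for S
  proof (cases "N = 1")
    case True
    interpret comm: comm_group G
      using comm_group_if_N_eq_1[OF True] .
    obtain g S' where S': "S = add_mset g S'"
      using S unfolding minimal_product_one_def by (meson multiset_cases)
    then have "product_one_free G S'"
      using S comm.minimal_product_one_remove1 by blast
    then show ?thesis
      using product_one_free_size_bound[OF assms] S' True by fastforce
  next
    case False
    then show ?thesis
      using minimal_product_one_size_bound S N_pos by simp
  qed
  obtain S where S: "minimal_product_one G S" "int (size S) = n + N"
    using minimal_product_one_example .
  have "Max {size S | S. minimal_product_one G S} = nat (n + N)"
  proof (rule Max_eqI)
    show "finite {size S | S. minimal_product_one G S}"
      by (rule finite_minimal_product_one_sizes[OF finite_carrier])
    show "m \<le> nat (n + N)" if "m \<in> {size S | S. minimal_product_one G S}" for m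
      using that le by fastforce
    show "nat (n + N) \<in> {size S | S. minimal_product_one G S}"
      using S by (intro CollectI exI[of _ S]) simp
  qed
  then show ?thesis
    unfolding large_davenport_def using n_pos N_pos by simp
qed

end

section \<open>Passage from the subgroup to coordinates\<close>

text \<open>By counting, \<open>G\<close> is the union of \<open>H\<close> and
  \<open>H #> x\<close>. The exponent \<open>r\<close> exists since \<open>x \<otimes> a\<close> in
  \<open>H\<close> would put \<open>x\<close> in \<open>H\<close>, and \<open>s\<close> exists since
  \<open>x \<otimes> x\<close> in \<open>H #> x\<close> would do the same.\<close>

lemma (in group) obtain_cyclic_index_two:
  assumes fin: "finite (carrier G)" and H: "subgroup H G" "cyclic_group (G\<lparr>carrier := H\<rparr>)"
    and idx: "card (rcosets H) = 2"
  obtains a x n r s where "cyclic_index_two G a x n r s"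
proof -
  interpret H: group "G\<lparr>carrier := H\<rparr>"
    by (rule subgroup.subgroup_is_group[OF H(1) group_axioms])
  obtain a where a: "a \<in> H" "H = range (\<lambda>i :: int. a [^]\<^bsub>G\<lparr>carrier := H\<rparr>\<^esub> i)"
    using H(2) unfolding H.cyclic_group by auto
  have sub: "H \<subseteq> carrier G"
    by (rule subgroup.subset[OF H(1)])
  have H_eq: "H = range (\<lambda>i :: int. a [^] i)"
    using a int_pow_consistent[OF H(1) a(1)] by auto
  have ac: "a \<in> carrier G"
    using a sub by blast
  have order: "order G = 2 * card H"
    using lagrange[OF H(1)] idx by simp
  have card_H: "0 < card H"
    using H(1) fin sub by (metis card_gt_0_iff empty_iff finite_subset subgroup.one_closed)
  have "H \<noteq> carrier G"
    using order card_H unfolding order_def by auto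
  then obtain x where x: "x \<in> carrier G" "x \<notin> H"
    using sub by blast
  have Hx: "carrier G = H \<union> (H #> x)"
  proof (rule sym, rule card_subset_eq[OF fin])
    have card_Hx: "card (H #> x) = card H"
      using card_rcosets_equal[OF rcosetsI[OF sub x(1)] sub] by simp
    have "H \<inter> (H #> x) = {}"
    proof (rule ccontr)
      assume "H \<inter> (H #> x) \<noteq> {}"
      then obtain h where "h \<in> H" "h \<otimes> x \<in> H"
        unfolding r_coset_def by auto
      then have "inv h \<otimes> (h \<otimes> x) \<in> H"
        using H(1) by (simp add: subgroup.m_closed subgroup.m_inv_closed)
      then show False
        using x sub \<open>h \<in> H\<close> by (auto simp: m_assoc[symmetric])
    qed
    then show "card (H \<union> (H #> x)) = card (carrier G)"
      using card_Hx order finite_subset[OF sub fin] finite_subset[OF r_coset_subset_G[OF sub x(1)] fin]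
      unfolding order_def by (subst card_Un_disjoint) auto
    show "H \<union> (H #> x) \<subseteq> carrier G"
      using sub r_coset_subset_G[OF sub x(1)] by auto
  qed
  have cases: "\<exists>i :: int. g = a [^] i \<or> g = a [^] i \<otimes> x" if "g \<in> carrier G" for g
    using that unfolding Hx r_coset_def H_eq by auto
  have not_H: "a [^] (i :: int) \<otimes> x \<notin> H" for i
  proof
    assume "a [^] i \<otimes> x \<in> H"
    moreover have "a [^] i \<in> H"
      unfolding H_eq by simp
    ultimately have "inv (a [^] i) \<otimes> (a [^] i \<otimes> x) \<in> H"
      using H(1) by (meson subgroup.m_closed subgroup.m_inv_closed)
    then show False
      using x ac by (simp add: m_assoc[symmetric])
  qed
  obtain r where r: "x \<otimes> a = a [^] (r :: int) \<otimes> x"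
  proof -
    have "x \<otimes> a \<noteq> a [^] (i :: int)" for i
    proof
      assume "x \<otimes> a = a [^] i"
      then have "x \<otimes> a \<in> H"
        by (simp add: H_eq)
      then have "x \<otimes> a \<otimes> inv a \<in> H"
        using H(1) a(1) by (meson subgroup.m_closed subgroup.m_inv_closed)
      then show False
        using x ac by (simp add: m_assoc)
    qed
    then show thesis
      using that cases[of "x \<otimes> a"] x(1) ac by blast
  qed
  obtain s where s: "x \<otimes> x = a [^] (s :: int)"
  proof -
    have "x \<otimes> x \<noteq> a [^] (i :: int) \<otimes> x" for i
      using x ac H_eq by (auto simp: r_cancel)
    then show thesis
      using that cases[of "x \<otimes> x"] x(1) by blast
  qed
  have "cyclic_index_two G a x (int (ord a)) r s"
  proof (unfold_locales)
    show "0 < int (ord a)"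
      using ord_ge_1[OF fin ac] by simp
  qed (use ac x cases r s H_eq int_pow_eq_id[OF ac] in auto)
  then show thesis
    by (rule that)
qed

theorem theorem1p1:
  fixes G :: "('a, 'b) monoid_scheme"
  assumes "group G"
    and "finite (carrier G)"
    and "\<exists>H. subgroup H G \<and> cyclic_group (G\<lparr>carrier := H\<rparr>) \<and> card (rcosets\<^bsub>G\<^esub> H) = 2"
  shows "large_davenport G = small_davenport G + card (derived G (carrier G)) \<and>
    real (small_davenport G) =
      (if cyclic_group G then real (order G) - 1 else real (order G) / 2)"
proof (cases "cyclic_group G")
  case True
  then show ?thesis
    using group.cyclic_group_davenport[OF assms(1,2)] by auto
next
  case False
  interpret group G
    by fact
  obtain a x n r s where "cyclic_index_two G a x n r s"
    using assms(2,3) obtain_cyclic_index_two by blast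
  then interpret cyclic_index_two G a x n r s .
  have "int (large_davenport G) = int (small_davenport G + card (derived G (carrier G)))"
    using small_davenport_eq large_davenport_eq card_derived False by simp
  moreover have "2 * int (small_davenport G) = int (order G)"
    using small_davenport_eq[OF False] order_eq n_pos by simp
  ultimately show ?thesis
    using False by auto
qed

end
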